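(* Let $\widehat E=E+\varepsilon E_0$ and $\widehat F=F+\varepsilon F_0$ be dual matrices in $\mathbb{D}^{m\times n}$ whose dual Moore-Penrose generalized inverses (DMPGIs) exist, and let $r_e=\mathrm{rk}(E)$, $r_f=\mathrm{rk}(F)$. Then $\widehat E\overset{\rm D}{\leq}\widehat F$ (Dual-minus order) if and only if there are real orthogonal matrices $U$ (of order $m$) and $V$ (of order $n$) such that $$\widehat E=U\begin{pmatrix} D_1 & O & O \\ O & O & O \\ O & O & O \end{pmatrix}V^{T}+\varepsilon U\begin{pmatrix} E_1 & E_2 & E_3 \\ E_4 & O & O \\ E_7 & O & O \end{pmatrix}V^{T},$$ $$\widehat F=U\begin{pmatrix} D_1+RD_2S & RD_2 & O \\ D_2S & D_2 & O \\ O & O & O \end{pmatrix}V^{T}+\varepsilon U\begin{pmatrix} E_1+RM+NS-RF_5S & E_2+N & E_3+RF_6 \\ E_4+M & F_5 & F_6 \\ E_7+F_8S & F_8 & O \end{pmatrix}V^{T},$$ where $D_1\in\mathbb{R}^{r_e\times r_e}$ and $D_2\in\mathbb{R}^{(r_f-r_e)\times(r_f-r_e)}$ are invertible, $M,S\in\mathbb{R}^{(r_f-r_e)\times r_e}$ and $N,R\in\mathbb{R}^{r_e\times(r_f-r_e)}$ are some suitable matrices, and $E_1,E_2,E_3,E_4,E_7,F_5,F_6,F_8$ are real matrices of conformable sizes.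
   Context: $\varepsilon$ is the dual unit: $\varepsilon\neq 0$, $\varepsilon^2=0$, commuting with reals. $\mathbb{D}^{m\times n}$ is the set of $m\times n$ dual matrices $\widehat E=E+\varepsilon E_0$ with $E,E_0\in\mathbb{R}^{m\times n}$, with the obvious addition, multiplication and transpose $\widehat E^{T}=E^T+\varepsilon E_0^T$. The DMPGI of $\widehat E\in\mathbb{D}^{m\times n}$ is the unique $\widehat X\in\mathbb{D}^{n\times m}$, if it exists, with $\widehat E\widehat X\widehat E=\widehat E$, $\widehat X\widehat E\widehat X=\widehat X$, $(\widehat E\widehat X)^T=\widehat E\widehat X$, $(\widehat X\widehat E)^T=\widehat X\widehat E$. Minus partial order on real matrices of the same size: $E\leq F$ means $\mathrm{rk}(F-E)=\mathrm{rk}(F)-\mathrm{rk}(E)$. Dual-minus order: for $\widehat E,\widehat F\in\mathbb{D}^{m\times n}$ whose DMPGIs exist, $\widehat E\overset{\rm D}{\leq}\widehat F$ means that $E\leq F$ and the DMPGI of $\widehat F-\widehat E$ exists. All $3\times3$ block matrices are partitioned with block-row sizes $r_e,\ r_f-r_e,\ m-r_f$ and block-column sizes $r_e,\ r_f-r_e,\ n-r_f$; $O$ denotes zero blocks, and blocks of size zero are allowed. *)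

theory Defs
  imports "Jordan_Normal_Form.DL_Rank"
begin

section \<open>Dual numbers\<close>

datatype dual_num = Dual_Num (std_part: real) (inf_part: real)

lemma dual_num_eq_iff: "x = y \<longleftrightarrow> std_part x = std_part y \<and> inf_part x = inf_part y"
  by (cases x; cases y) auto

instantiation dual_num :: "{comm_ring_1, real_algebra_1}"
begin

definition zero_dual_num :: dual_num where
  "0 = Dual_Num 0 0"

definition one_dual_num :: dual_num where
  "1 = Dual_Num 1 0"

definition plus_dual_num :: "dual_num \<Rightarrow> dual_num \<Rightarrow> dual_num" where
  "x + y = Dual_Num (std_part x + std_part y) (inf_part x + inf_part y)"

definition uminus_dual_num :: "dual_num \<Rightarrow> dual_num" where
  "- x = Dual_Num (- std_part x) (- inf_part x)"

definition minus_dual_num :: "dual_num \<Rightarrow> dual_num \<Rightarrow> dual_num" where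
  "x - y = Dual_Num (std_part x - std_part y) (inf_part x - inf_part y)"

definition times_dual_num :: "dual_num \<Rightarrow> dual_num \<Rightarrow> dual_num" where
  "x * y = Dual_Num (std_part x * std_part y)
                    (std_part x * inf_part y + inf_part x * std_part y)"

definition scaleR_dual_num :: "real \<Rightarrow> dual_num \<Rightarrow> dual_num" where
  "c *\<^sub>R x = Dual_Num (c * std_part x) (c * inf_part x)"

instance
  by standard
    (simp_all add: dual_num_eq_iff zero_dual_num_def one_dual_num_def plus_dual_num_def
      uminus_dual_num_def minus_dual_num_def times_dual_num_def scaleR_dual_num_def algebra_simps)

end

lemma dual_num_parts [simp]:
  "std_part 0 = 0" "inf_part 0 = 0"
  "std_part 1 = 1" "inf_part 1 = 0"
  "std_part (x + y) = std_part x + std_part y" "inf_part (x + y) = inf_part x + inf_part y"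
  "std_part (- x) = - std_part x" "inf_part (- x) = - inf_part x"
  "std_part (x - y) = std_part x - std_part y" "inf_part (x - y) = inf_part x - inf_part y"
  "std_part (x * y) = std_part x * std_part y"
  "inf_part (x * y) = std_part x * inf_part y + inf_part x * std_part y"
  "std_part (of_real c) = c" "inf_part (of_real c) = 0"
  by (simp_all add: zero_dual_num_def one_dual_num_def plus_dual_num_def uminus_dual_num_def
      minus_dual_num_def times_dual_num_def of_real_def scaleR_dual_num_def)

definition dual_unit :: dual_num ("\<epsilon>") where
  "\<epsilon> = Dual_Num 0 1"

lemma dual_unit_nonzero: "\<epsilon> \<noteq> 0"
  by (simp add: dual_num_eq_iff dual_unit_def)

lemma dual_unit_squared: "\<epsilon> * \<epsilon> = 0"
  by (simp add: dual_num_eq_iff dual_unit_def)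


section \<open>Dual matrices\<close>

definition dual_mat :: "real mat \<Rightarrow> real mat \<Rightarrow> dual_num mat" where
  "dual_mat A B = map_mat of_real A + \<epsilon> \<cdot>\<^sub>m map_mat of_real B"

definition std_mat :: "dual_num mat \<Rightarrow> real mat" where
  "std_mat A = map_mat std_part A"

lemma dual_mat_carrier [simp, intro]:
  "B \<in> carrier_mat m n \<Longrightarrow> dual_mat A B \<in> carrier_mat m n"
  by (auto simp: dual_mat_def)

lemma std_mat_dual_mat [simp]:
  assumes "A \<in> carrier_mat m n" "B \<in> carrier_mat m n"
  shows "std_mat (dual_mat A B) = A"
  using assms by (intro eq_matI) (auto simp: std_mat_def dual_mat_def dual_unit_def)

definition is_dmpgi :: "dual_num mat \<Rightarrow> dual_num mat \<Rightarrow> bool" where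
  "is_dmpgi A X \<longleftrightarrow>
     X \<in> carrier_mat (dim_col A) (dim_row A) \<and>
     A * X * A = A \<and> X * A * X = X \<and>
     transpose_mat (A * X) = A * X \<and> transpose_mat (X * A) = X * A"

definition has_dmpgi :: "dual_num mat \<Rightarrow> bool" where
  "has_dmpgi A \<longleftrightarrow> (\<exists>X. is_dmpgi A X)"

lemma is_dmpgi_unique:
  assumes X: "is_dmpgi A X" and Y: "is_dmpgi A Y"
  shows "X = Y"
proof -
  define m n where "m = dim_row A" and "n = dim_col A"
  have A: "A \<in> carrier_mat m n" by (simp add: m_def n_def)
  have Xc: "X \<in> carrier_mat n m" and Yc: "Y \<in> carrier_mat n m"
    using X Y by (auto simp: is_dmpgi_def m_def n_def)
  note carr = A Xc Yc mult_carrier_mat[OF A Xc] mult_carrier_mat[OF A Yc]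
    mult_carrier_mat[OF Xc A] mult_carrier_mat[OF Yc A]
  note Xs = X[unfolded is_dmpgi_def] and Ys = Y[unfolded is_dmpgi_def]
  have "A * X = A * Y * A * X" using Ys by simp
  also have "\<dots> = (A * Y) * (A * X)"
    by (rule assoc_mult_mat) (use carr in auto)
  finally have "transpose_mat (A * X) = transpose_mat ((A * Y) * (A * X))" by simp
  also have "\<dots> = transpose_mat (A * X) * transpose_mat (A * Y)"
    by (rule transpose_mult) (use carr in auto)
  also have "\<dots> = (A * X) * (A * Y)" using Xs Ys by simp
  also have "\<dots> = A * X * A * Y"
    by (rule assoc_mult_mat[symmetric]) (use carr in auto)
  finally have AX: "A * X = A * Y" using Xs by simp
  have "X * A = X * (A * Y * A)" using Ys by simp
  also have "\<dots> = X * (A * (Y * A))"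
    by (subst assoc_mult_mat[of A m n Y m A n]) (use carr in auto)
  also have "\<dots> = (X * A) * (Y * A)"
    by (rule assoc_mult_mat[symmetric]) (use carr in auto)
  finally have "transpose_mat (X * A) = transpose_mat ((X * A) * (Y * A))" by simp
  also have "\<dots> = transpose_mat (Y * A) * transpose_mat (X * A)"
    by (rule transpose_mult) (use carr in auto)
  also have "\<dots> = (Y * A) * (X * A)" using Xs Ys by simp
  also have "\<dots> = Y * (A * (X * A))"
    by (rule assoc_mult_mat) (use carr in auto)
  also have "\<dots> = Y * (A * X * A)"
    by (subst assoc_mult_mat[of A m n X m A n]) (use carr in auto)
  finally have XA: "X * A = Y * A" using Xs by simp
  have "X = Y * A * X" using Xs XA by simp
  also have "\<dots> = Y * (A * X)" by (rule assoc_mult_mat) (use carr in auto)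
  also have "\<dots> = Y * A * Y" unfolding AX
    by (rule assoc_mult_mat[symmetric]) (use carr in auto)
  finally show ?thesis using Ys by simp
qed


section \<open>Partial orders\<close>

abbreviation mat_rank :: "real mat \<Rightarrow> nat" where
  "mat_rank A \<equiv> vec_space.rank (dim_row A) A"

text \<open>The difference of the ranks is taken in the integers, since subtraction of natural
  numbers truncates.\<close>

definition minus_le :: "real mat \<Rightarrow> real mat \<Rightarrow> bool" where
  "minus_le E F \<longleftrightarrow>
     dim_row E = dim_row F \<and> dim_col E = dim_col F \<and>
     int (mat_rank (F - E)) = int (mat_rank F) - int (mat_rank E)"

definition dual_minus_le :: "dual_num mat \<Rightarrow> dual_num mat \<Rightarrow> bool" where
  "dual_minus_le A B \<longleftrightarrow>
     dim_row A = dim_row B \<and> dim_col A = dim_col B \<and> has_dmpgi A \<and> has_dmpgi B \<and>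
     minus_le (std_mat A) (std_mat B) \<and> has_dmpgi (B - A)"


section \<open>Orthogonal matrices and block matrices\<close>

text \<open>The library predicate \<^const>\<open>orthogonal_mat\<close> only asks for nonzero, pairwise orthogonal
  columns, so it is not usable here.\<close>

definition real_orthogonal :: "nat \<Rightarrow> real mat \<Rightarrow> bool" where
  "real_orthogonal k Q \<longleftrightarrow>
     Q \<in> carrier_mat k k \<and> transpose_mat Q * Q = 1\<^sub>m k \<and> Q * transpose_mat Q = 1\<^sub>m k"

definition append_cols :: "real mat \<Rightarrow> real mat \<Rightarrow> real mat" (infixr "@\<^sub>c" 70) where
  "A @\<^sub>c B = four_block_mat A B (0\<^sub>m 0 (dim_col A)) (0\<^sub>m 0 (dim_col B))"

definition block3_mat ::
  "real mat \<Rightarrow> real mat \<Rightarrow> real mat \<Rightarrow> real mat \<Rightarrow> real mat \<Rightarrow> real mat \<Rightarrow>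
   real mat \<Rightarrow> real mat \<Rightarrow> real mat \<Rightarrow> real mat" where
  "block3_mat A11 A12 A13 A21 A22 A23 A31 A32 A33 =
     (A11 @\<^sub>c A12 @\<^sub>c A13) @\<^sub>r
     (A21 @\<^sub>c A22 @\<^sub>c A23) @\<^sub>r
     (A31 @\<^sub>c A32 @\<^sub>c A33)"

lemma append_cols_carrier [simp, intro]:
  "A \<in> carrier_mat r c1 \<Longrightarrow> B \<in> carrier_mat r c2 \<Longrightarrow> A @\<^sub>c B \<in> carrier_mat r (c1 + c2)"
  by (auto simp: append_cols_def)

lemma append_cols_index:
  assumes "A \<in> carrier_mat r c1" "B \<in> carrier_mat r c2" "i < r" "j < c1 + c2"
  shows "(A @\<^sub>c B) $$ (i, j) = (if j < c1 then A $$ (i, j) else B $$ (i, j - c1))"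
  using assms by (auto simp: append_cols_def)

end

theory Submission
  imports Defs
begin

text \<open>A dual matrix \<open>A + \<epsilon> A\<^sub>0\<close> with a DMPGI satisfies \<open>A\<^sub>0 = A P + Q A\<close> for some real \<open>P\<close>, \<open>Q\<close>;
  conversely, if \<open>A = L T\<close> is a full rank factorization and \<open>A\<^sub>0 = L W + Z T\<close>, then
  \<open>A + \<epsilon> A\<^sub>0 = (L + \<epsilon> Z) (T + \<epsilon> W)\<close>, and multiplying the one-sided inverses
  \<open>(X\<^sup>T X)\<^sup>-\<^sup>1 X\<^sup>T\<close> of the (transposed) factors gives the DMPGI.

  If \<open>E \<le> F\<close>, take full rank factorizations \<open>E = L\<^sub>1 T\<^sub>1\<close> and \<open>F - E = L\<^sub>2 T\<^sub>2\<close> and let \<open>U\<close>, \<open>V\<close> be the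
  orthogonal factors of QR decompositions of \<open>(L\<^sub>1 L\<^sub>2)\<close> and \<open>(T\<^sub>1\<^sup>T T\<^sub>2\<^sup>T)\<close>. The triangular
  factors have invertible diagonal blocks, because otherwise \<open>E\<close> or \<open>F\<close> would have too small a rank, and this
  yields the standard parts. The infinitesimal parts are read off from \<open>A\<^sub>0 = A P + Q A\<close> for
  \<open>A = E\<close> and \<open>A = F - E\<close>. In the other direction the block form displays \<open>F - E\<close> as a product through
  dimension \<open>r\<^sub>f - r\<^sub>e\<close>, which bounds its rank, and its dual part has the shape \<open>L W + Z T\<close>.\<close>

section \<open>Rank and factorizations\<close>

text \<open>Each vector \<open>(L * T) *\<^sub>v x\<close> equals
  \<open>L *\<^sub>v (T *\<^sub>v x)\<close>, so the column space of the product is nested in that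
  of \<open>L\<close>, and dimension is monotone on nested subspaces.\<close>

lemma rank_mult_le:
  assumes L: "L \<in> carrier_mat m k" and T: "T \<in> carrier_mat k n"
  shows "mat_rank (L * T) \<le> mat_rank L"
proof -
  interpret vec_space "TYPE(real)" m .
  let ?X = "span (set (cols (L * T)))" and ?W = "span (set (cols L))"
  have LT: "L * T \<in> carrier_mat m n" using L T by auto
  have cX: "set (cols (L * T)) \<subseteq> carrier_vec m" and cW: "set (cols L) \<subseteq> carrier_vec m"
    using L LT cols_dim by blast+
  have "y \<in> ?W" if "y \<in> ?X" for y
  proof -
    from that obtain x where x: "x \<in> carrier_vec n" "y = (L * T) *\<^sub>v x"
      using LT T unfolding col_space_eq[OF LT, unfolded col_space_def] by auto
    hence "y = L *\<^sub>v (T *\<^sub>v x)" using L T by (simp add: assoc_mult_mat_vec)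
    thus ?thesis using L T x unfolding col_space_eq[OF L, unfolded col_space_def] by auto
  qed
  hence sub: "?X \<subseteq> ?W" by blast
  have sW: "subspace class_ring ?W V" and sX: "subspace class_ring ?X V"
    using span_is_subspace cX cW by auto
  have "vectorspace.dim class_ring (vs ?X) \<le> vectorspace.dim class_ring (vs ?W)"
    using vectorspace.subspace_dim[OF subspace_is_vs[OF sW] nested_subspaces[OF sW sX sub]]
      fin_dim_span_cols[OF L] fin_dim_span_cols[OF LT] by auto
  thus ?thesis using L by (simp add: rank_def)
qed

text \<open>This is how ranks are bounded from above later on: a matrix is displayed as a product
  through a small inner dimension.\<close>

lemma rank_mult_le_inner:
  assumes "L \<in> carrier_mat m k" "T \<in> carrier_mat k n"
  shows "mat_rank (L * T) \<le> k"
  using rank_mult_le[OF assms] vec_space.rank_le_nc[of L "dim_row L"] assms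
  by (metis carrier_matD(1) dual_order.trans)

text \<open>The columns of \<open>L\<close> are a basis of the column space of \<open>A\<close>, and
  column j of \<open>T\<close> holds the coordinates of column j of \<open>A\<close> in that
  basis.\<close>

lemma rank_factorization:
  assumes A: "A \<in> carrier_mat m n"
  obtains L T where "L \<in> carrier_mat m (mat_rank A)" "T \<in> carrier_mat (mat_rank A) n" "A = L * T"
proof -
  interpret vec_space "TYPE(real)" m .
  let ?X = "span (set (cols A))"
  have cX: "set (cols A) \<subseteq> carrier_vec m" using A cols_dim by blast
  have sX: "subspace class_ring ?X V" using span_is_subspace cX by auto
  interpret W: vectorspace class_ring "vs ?X" by (rule subspace_is_vs[OF sX])
  obtain b where fb: "finite b" and b: "W.basis b"
    using W.finite_basis_exists fin_dim_span_cols[OF A] by auto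
  have bX: "b \<subseteq> ?X" using b W.basis_def by auto
  have bV: "b \<subseteq> carrier_vec m" using bX cX span_closed by auto
  \<comment> \<open>\<open>b\<close> is a basis of the column space regarded as a vector space of
    its own; its span there agrees with the span in the ambient space.\<close>
  have spb: "span b = ?X"
    using span_li_not_depend(1)[OF bX] sX b W.basis_def subspace_def by auto
  have cb: "card b = mat_rank A"
    using W.dim_basis[OF fb b] A by (simp add: rank_def)
  obtain bs where bs: "set bs = b" "distinct bs" using fb finite_distinct_list by auto
  define L where "L = mat_of_cols m bs"
  have cL: "L \<in> carrier_mat m (mat_rank A)"
    using bs cb distinct_card[of bs] by (auto simp: L_def)
  have colsL: "set (cols L) = b" using bs bV by (simp add: L_def)
  have "\<exists>x \<in> carrier_vec (mat_rank A). L *\<^sub>v x = col A j" if "j < n" for j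
  proof -
    have "col A j \<in> span (set (cols L))"
      using that A span_mem[OF cX, of "col A j"] unfolding colsL spb
      by (metis carrier_matD(2) cols_length cols_nth nth_mem)
    thus ?thesis using cL unfolding col_space_eq[OF cL, unfolded col_space_def] by auto
  qed
  then obtain x where x: "\<And>j. j < n \<Longrightarrow> x j \<in> carrier_vec (mat_rank A) \<and> L *\<^sub>v x j = col A j"
    by metis
  define T where "T = mat_of_cols (mat_rank A) (map x [0..<n])"
  have cT: "T \<in> carrier_mat (mat_rank A) n" by (auto simp: T_def)
  have "A = L * T"
  proof (rule eq_matI)
    fix i j assume "i < dim_row (L * T)" "j < dim_col (L * T)"
    hence ij: "i < m" "j < n" using cL cT by auto
    have "col T j = x j" using x ij by (simp add: T_def)
    hence "(L * T) $$ (i, j) = (L *\<^sub>v x j) $ i" using ij cL cT by auto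
    thus "A $$ (i, j) = (L * T) $$ (i, j)" using x ij A by simp
  qed (use A cL cT in auto)
  thus thesis using that cL cT by blast
qed

text \<open>Transposing a full rank factorization of \<open>A\<close> gives a factorization of the
  transpose through the same inner dimension.\<close>

lemma rank_transpose_le:
  assumes A: "A \<in> carrier_mat m n"
  shows "mat_rank (transpose_mat A) \<le> mat_rank A"
proof -
  obtain L T where "L \<in> carrier_mat m (mat_rank A)" "T \<in> carrier_mat (mat_rank A) n" "A = L * T"
    using rank_factorization[OF A] .
  thus ?thesis
    using rank_mult_le_inner[of "transpose_mat T" n "mat_rank A" "transpose_mat L" m] transpose_mult
    by (metis transpose_carrier_mat)
qed

lemma rank_transpose:
  assumes A: "A \<in> carrier_mat m n"
  shows "mat_rank (transpose_mat A) = mat_rank A"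
  using rank_transpose_le[OF A] rank_transpose_le[of "transpose_mat A" n m] A by simp

lemma rank_add_le:
  assumes "A \<in> carrier_mat m n" "B \<in> carrier_mat m n"
  shows "mat_rank (A + B) \<le> mat_rank A + mat_rank B"
  using vec_space.rank_subadditive[OF assms] assms by auto

section \<open>Block matrices\<close>

lemma append_rows_index:
  assumes "A \<in> carrier_mat r1 c" "B \<in> carrier_mat r2 c" "i < r1 + r2" "j < c"
  shows "(A @\<^sub>r B) $$ (i, j) = (if i < r1 then A $$ (i, j) else B $$ (i - r1, j))"
  using assms by (auto simp: append_rows_def)

lemma append_rows_mult:
  fixes A B C :: "'a :: comm_semiring_0 mat"
  assumes "A \<in> carrier_mat r1 k" "B \<in> carrier_mat r2 k" "C \<in> carrier_mat k c"
  shows "(A @\<^sub>r B) * C = A * C @\<^sub>r B * C"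
proof (rule eq_matI)
  fix i j assume "i < dim_row (A * C @\<^sub>r B * C)" "j < dim_col (A * C @\<^sub>r B * C)"
  hence ij: "i < r1 + r2" "j < c" using assms by (auto simp: append_rows_def)
  have "row (A @\<^sub>r B) i = (if i < r1 then row A i else row B (i - r1))"
    using assms ij by (intro eq_vecI) (auto simp: append_rows_def)
  moreover have "i < dim_row (A @\<^sub>r B)" using assms ij by (simp add: append_rows_def)
  ultimately show "((A @\<^sub>r B) * C) $$ (i, j) = (A * C @\<^sub>r B * C) $$ (i, j)"
    using assms ij append_rows_index[of "A * C" r1 c "B * C" r2 i j] by auto
qed (use assms in \<open>auto simp: append_rows_def\<close>)

lemma transpose_append_rows:
  "A \<in> carrier_mat r1 c \<Longrightarrow> B \<in> carrier_mat r2 c \<Longrightarrow>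
    transpose_mat (A @\<^sub>r B) = transpose_mat A @\<^sub>c transpose_mat B"
  by (rule eq_matI) (auto simp: append_rows_def append_cols_def)

lemma transpose_append_cols:
  "A \<in> carrier_mat r c1 \<Longrightarrow> B \<in> carrier_mat r c2 \<Longrightarrow>
    transpose_mat (A @\<^sub>c B) = transpose_mat A @\<^sub>r transpose_mat B"
  by (rule eq_matI) (auto simp: append_rows_def append_cols_def)

text \<open>The transpose of \<open>append_rows_mult\<close>.\<close>

lemma mult_append_cols:
  assumes "A \<in> carrier_mat k c1" "B \<in> carrier_mat k c2" "C \<in> carrier_mat r k"
  shows "C * (A @\<^sub>c B) = (C * A) @\<^sub>c (C * B)"
proof -
  have "transpose_mat (C * (A @\<^sub>c B)) = transpose_mat ((C * A) @\<^sub>c (C * B))"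
    using assms transpose_mult[OF assms(3,1)] transpose_mult[OF assms(3,2)]
      transpose_mult[OF assms(3) append_cols_carrier[OF assms(1,2)]]
      transpose_append_cols[OF assms(1,2)] transpose_append_cols[of "C * A" r c1 "C * B" c2]
      append_rows_mult[of "transpose_mat A" c1 k "transpose_mat B" c2 "transpose_mat C" r]
    by auto
  thus ?thesis by (metis transpose_transpose)
qed

lemma append_cols_mult_append_rows:
  assumes "A \<in> carrier_mat r k1" "B \<in> carrier_mat r k2" "C \<in> carrier_mat k1 c" "D \<in> carrier_mat k2 c"
  shows "(A @\<^sub>c B) * (C @\<^sub>r D) = A * C + B * D"
proof (rule eq_matI)
  fix i j assume "i < dim_row (A * C + B * D)" "j < dim_col (A * C + B * D)"
  hence ij: "i < r" "j < c" using assms by auto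
  have "row (A @\<^sub>c B) i = row A i @\<^sub>v row B i"
    using assms ij by (intro eq_vecI) (auto simp: append_cols_def)
  moreover have "col (C @\<^sub>r D) j = col C j @\<^sub>v col D j"
    using assms ij by (intro eq_vecI) (auto simp: append_rows_def)
  moreover have "i < dim_row (A @\<^sub>c B)" "j < dim_col (C @\<^sub>r D)"
    using assms ij by (auto simp: append_rows_def append_cols_def)
  ultimately show "((A @\<^sub>c B) * (C @\<^sub>r D)) $$ (i, j) = (A * C + B * D) $$ (i, j)"
    using assms ij scalar_prod_append[of "row A i" k1 "row B i" k2 "col C j" "col D j"]
    by simp
qed (use assms in \<open>auto simp: append_rows_def append_cols_def\<close>)

lemma append_rows_add:
  "A \<in> carrier_mat r1 c \<Longrightarrow> B \<in> carrier_mat r2 c \<Longrightarrow> C \<in> carrier_mat r1 c \<Longrightarrow> D \<in> carrier_mat r2 c \<Longrightarrow>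
    (A @\<^sub>r B) + (C @\<^sub>r D) = (A + C :: 'a :: monoid_add mat) @\<^sub>r (B + D)"
  by (rule eq_matI) (auto simp: append_rows_def)

lemma append_cols_add:
  "A \<in> carrier_mat r c1 \<Longrightarrow> B \<in> carrier_mat r c2 \<Longrightarrow> C \<in> carrier_mat r c1 \<Longrightarrow> D \<in> carrier_mat r c2 \<Longrightarrow>
    (A @\<^sub>c B) + (C @\<^sub>c D) = (A + C) @\<^sub>c (B + D)"
  by (rule eq_matI) (auto simp: append_cols_def)

lemma append_rows_split:
  assumes "X \<in> carrier_mat (r1 + r2) c"
  obtains A B where "A \<in> carrier_mat r1 c" "B \<in> carrier_mat r2 c" "X = A @\<^sub>r B"
proof
  show "X = mat r1 c (\<lambda>(i, j). X $$ (i, j)) @\<^sub>r mat r2 c (\<lambda>(i, j). X $$ (i + r1, j))"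
    using assms by (intro eq_matI) (auto simp: append_rows_def)
qed auto

lemma append_cols_split:
  assumes "X \<in> carrier_mat r (c1 + c2)"
  obtains A B where "A \<in> carrier_mat r c1" "B \<in> carrier_mat r c2" "X = A @\<^sub>c B"
proof
  show "X = mat r c1 (\<lambda>(i, j). X $$ (i, j)) @\<^sub>c mat r c2 (\<lambda>(i, j). X $$ (i, j + c1))"
    using assms by (intro eq_matI) (auto simp: append_cols_def)
qed auto

lemma append_rows_split3:
  assumes "X \<in> carrier_mat (r1 + (r2 + r3)) c"
  obtains A B C where "A \<in> carrier_mat r1 c" "B \<in> carrier_mat r2 c" "C \<in> carrier_mat r3 c"
    "X = A @\<^sub>r B @\<^sub>r C"
  using append_rows_split assms by metis

lemma append_cols_split3:
  assumes "X \<in> carrier_mat r (c1 + (c2 + c3))"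
  obtains A B C where "A \<in> carrier_mat r c1" "B \<in> carrier_mat r c2" "C \<in> carrier_mat r c3"
    "X = A @\<^sub>c B @\<^sub>c C"
  using append_cols_split assms by metis

text \<open>Appending nests to the right, so sizes are bracketed to the right throughout, as in
  \<open>a + (b + c)\<close>.\<close>

lemma append_cols3_carrier:
  "A \<in> carrier_mat r c1 \<Longrightarrow> B \<in> carrier_mat r c2 \<Longrightarrow> C \<in> carrier_mat r c3 \<Longrightarrow>
    A @\<^sub>c B @\<^sub>c C \<in> carrier_mat r (c1 + (c2 + c3))"
  by auto

lemma append_rows3_carrier:
  "A \<in> carrier_mat r1 c \<Longrightarrow> B \<in> carrier_mat r2 c \<Longrightarrow> C \<in> carrier_mat r3 c \<Longrightarrow>
    A @\<^sub>r B @\<^sub>r C \<in> carrier_mat (r1 + (r2 + r3)) c"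
  by auto

text \<open>Block form of an outer product. It converts a factorization through dimension
  \<open>k\<close> into the nine displayed blocks.\<close>

lemma append_rows3_mult_append_cols3:
  assumes "L1 \<in> carrier_mat r1 k" "L2 \<in> carrier_mat r2 k" "L3 \<in> carrier_mat r3 k"
    and "T1 \<in> carrier_mat k c1" "T2 \<in> carrier_mat k c2" "T3 \<in> carrier_mat k c3"
  shows "(L1 @\<^sub>r L2 @\<^sub>r L3) * (T1 @\<^sub>c T2 @\<^sub>c T3) =
    block3_mat (L1 * T1) (L1 * T2) (L1 * T3) (L2 * T1) (L2 * T2) (L2 * T3) (L3 * T1) (L3 * T2) (L3 * T3)"
proof -
  note T = append_cols3_carrier[OF assms(4-6)]
  have *: "L * (T1 @\<^sub>c T2 @\<^sub>c T3) = (L * T1) @\<^sub>c (L * T2) @\<^sub>c (L * T3)" if "L \<in> carrier_mat r k" for L r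
    using that assms mult_append_cols[OF assms(4) append_cols_carrier[OF assms(5,6)] that]
      mult_append_cols[OF assms(5,6) that] by simp
  show ?thesis
    unfolding block3_mat_def *[OF assms(1), symmetric] *[OF assms(2), symmetric] *[OF assms(3), symmetric]
    using append_rows_mult[OF assms(1) carrier_append_rows[OF assms(2,3)] T]
      append_rows_mult[OF assms(2,3) T] by simp
qed

lemma append_rows3_mult:
  fixes A B C X :: "'a :: comm_semiring_0 mat"
  assumes "A \<in> carrier_mat r1 k" "B \<in> carrier_mat r2 k" "C \<in> carrier_mat r3 k" "X \<in> carrier_mat k c"
  shows "(A @\<^sub>r B @\<^sub>r C) * X = A * X @\<^sub>r B * X @\<^sub>r C * X"
  using append_rows_mult[OF assms(1) carrier_append_rows[OF assms(2,3)] assms(4)]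
    append_rows_mult[OF assms(2-4)] by simp

lemma append_rows3_add:
  assumes "A \<in> carrier_mat r1 c" "B \<in> carrier_mat r2 c" "C \<in> carrier_mat r3 c"
    and "A' \<in> carrier_mat r1 c" "B' \<in> carrier_mat r2 c" "C' \<in> carrier_mat r3 c"
  shows "(A @\<^sub>r B @\<^sub>r C) + (A' @\<^sub>r B' @\<^sub>r C') = (A + A' :: 'a :: monoid_add mat) @\<^sub>r (B + B') @\<^sub>r (C + C')"
  using append_rows_add[OF assms(1) _ assms(4)] append_rows_add[OF assms(2,3,5,6)]
    carrier_append_rows assms by metis

lemma append_cols3_mult_append_rows3:
  assumes "A1 \<in> carrier_mat r k1" "A2 \<in> carrier_mat r k2" "A3 \<in> carrier_mat r k3"
    and "B1 \<in> carrier_mat k1 c" "B2 \<in> carrier_mat k2 c" "B3 \<in> carrier_mat k3 c"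
  shows "(A1 @\<^sub>c A2 @\<^sub>c A3) * (B1 @\<^sub>r B2 @\<^sub>r B3) = A1 * B1 + (A2 * B2 + A3 * B3)"
  using append_cols_mult_append_rows[OF assms(1) _ assms(4)]
    append_cols_mult_append_rows[OF assms(2,3,5,6)] append_cols_carrier carrier_append_rows assms by metis

lemma block3_mat_carrier:
  assumes "A11 \<in> carrier_mat r1 c1" "A12 \<in> carrier_mat r1 c2" "A13 \<in> carrier_mat r1 c3"
    and "A21 \<in> carrier_mat r2 c1" "A22 \<in> carrier_mat r2 c2" "A23 \<in> carrier_mat r2 c3"
    and "A31 \<in> carrier_mat r3 c1" "A32 \<in> carrier_mat r3 c2" "A33 \<in> carrier_mat r3 c3"
  shows "block3_mat A11 A12 A13 A21 A22 A23 A31 A32 A33 \<in> carrier_mat (r1 + (r2 + r3)) (c1 + (c2 + c3))"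
  unfolding block3_mat_def using assms by (intro append_rows3_carrier append_cols3_carrier)

lemma block3_mat_add:
  assumes "A11 \<in> carrier_mat r1 c1" "A12 \<in> carrier_mat r1 c2" "A13 \<in> carrier_mat r1 c3"
    and "A21 \<in> carrier_mat r2 c1" "A22 \<in> carrier_mat r2 c2" "A23 \<in> carrier_mat r2 c3"
    and "A31 \<in> carrier_mat r3 c1" "A32 \<in> carrier_mat r3 c2" "A33 \<in> carrier_mat r3 c3"
    and "B11 \<in> carrier_mat r1 c1" "B12 \<in> carrier_mat r1 c2" "B13 \<in> carrier_mat r1 c3"
    and "B21 \<in> carrier_mat r2 c1" "B22 \<in> carrier_mat r2 c2" "B23 \<in> carrier_mat r2 c3"
    and "B31 \<in> carrier_mat r3 c1" "B32 \<in> carrier_mat r3 c2" "B33 \<in> carrier_mat r3 c3"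
  shows "block3_mat A11 A12 A13 A21 A22 A23 A31 A32 A33 + block3_mat B11 B12 B13 B21 B22 B23 B31 B32 B33 =
    block3_mat (A11 + B11) (A12 + B12) (A13 + B13) (A21 + B21) (A22 + B22) (A23 + B23)
      (A31 + B31) (A32 + B32) (A33 + B33)"
proof -
  have *: "(A @\<^sub>c B @\<^sub>c C) + (A' @\<^sub>c B' @\<^sub>c C') = (A + A') @\<^sub>c (B + B') @\<^sub>c (C + C')"
    if "A \<in> carrier_mat r c1" "B \<in> carrier_mat r c2" "C \<in> carrier_mat r c3"
      "A' \<in> carrier_mat r c1" "B' \<in> carrier_mat r c2" "C' \<in> carrier_mat r c3" for A B C A' B' C' r
    using append_cols_add[OF that(1) _ that(4)] append_cols_add[OF that(2,3,5,6)]
      append_cols_carrier that by metis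
  show ?thesis
    unfolding block3_mat_def
      *[OF assms(1-3) assms(10-12), symmetric] *[OF assms(4-6) assms(13-15), symmetric]
      *[OF assms(7-9) assms(16-18), symmetric]
    by (rule append_rows3_add[OF append_cols3_carrier[OF assms(1-3)] append_cols3_carrier[OF assms(4-6)]
          append_cols3_carrier[OF assms(7-9)] append_cols3_carrier[OF assms(10-12)]
          append_cols3_carrier[OF assms(13-15)] append_cols3_carrier[OF assms(16-18)]])
qed

section \<open>Dual matrices and their generalized inverses\<close>

lemma det_nonzero_obtain_inverse:
  fixes A :: "'a :: field mat"
  assumes A: "A \<in> carrier_mat n n" and "det A \<noteq> 0"
  obtains B where "B \<in> carrier_mat n n" "A * B = 1\<^sub>m n" "B * A = 1\<^sub>m n"
  using det_non_zero_imp_unit[OF assms] unfolding Units_def ring_mat_simps by auto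

lemma mult_mat_cancel_left:
  fixes A B C :: "'a :: comm_ring_1 mat"
  assumes "A \<in> carrier_mat n k" "B \<in> carrier_mat k n" "A * B = 1\<^sub>m n" "C \<in> carrier_mat n c"
  shows "A * (B * C) = C"
  unfolding assoc_mult_mat[OF assms(1,2,4), symmetric] assms(3) by (rule left_mult_one_mat[OF assms(4)])

lemma dual_mat_simps [simp]:
  "dim_row (dual_mat A B) = dim_row B" "dim_col (dual_mat A B) = dim_col B"
  by (simp_all add: dual_mat_def)

lemma dual_mat_index:
  assumes "A \<in> carrier_mat m n" "B \<in> carrier_mat m n" "i < m" "j < n"
  shows "dual_mat A B $$ (i, j) = Dual_Num (A $$ (i, j)) (B $$ (i, j))"
  using assms by (simp add: dual_mat_def dual_num_eq_iff dual_unit_def)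

lemma dual_mat_eq_iff:
  assumes "A \<in> carrier_mat m n" "A0 \<in> carrier_mat m n" "B \<in> carrier_mat m n" "B0 \<in> carrier_mat m n"
  shows "dual_mat A A0 = dual_mat B B0 \<longleftrightarrow> A = B \<and> A0 = B0"
proof
  assume eq: "dual_mat A A0 = dual_mat B B0"
  hence "Dual_Num (A $$ (i, j)) (A0 $$ (i, j)) = Dual_Num (B $$ (i, j)) (B0 $$ (i, j))"
    if "i < m" "j < n" for i j
    using that by (metis dual_mat_index assms)
  thus "A = B \<and> A0 = B0" using assms by (auto intro!: eq_matI)
qed auto

lemma dual_mat_cases:
  assumes "X \<in> carrier_mat m n"
  obtains A B where "A \<in> carrier_mat m n" "B \<in> carrier_mat m n" "X = dual_mat A B"
proof
  show "X = dual_mat (map_mat std_part X) (map_mat inf_part X)"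
    using assms by (intro eq_matI) (auto simp: dual_mat_index[of _ m n])
qed (use assms in auto)

lemma std_part_sum [simp]: "std_part (sum f A) = (\<Sum>x\<in>A. std_part (f x))"
  by (induction A rule: infinite_finite_induct) auto

lemma inf_part_sum [simp]: "inf_part (sum f A) = (\<Sum>x\<in>A. inf_part (f x))"
  by (induction A rule: infinite_finite_induct) auto

lemma dual_mat_mult:
  assumes "A \<in> carrier_mat m k" "A0 \<in> carrier_mat m k" "B \<in> carrier_mat k n" "B0 \<in> carrier_mat k n"
  shows "dual_mat A A0 * dual_mat B B0 = dual_mat (A * B) (A * B0 + A0 * B)"
proof (rule eq_matI)
  fix i j assume "i < dim_row (dual_mat (A * B) (A * B0 + A0 * B))" "j < dim_col (dual_mat (A * B) (A * B0 + A0 * B))"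
  hence ij: "i < m" "j < n" using assms by auto
  have "dual_mat (A * B) (A * B0 + A0 * B) $$ (i, j) =
      Dual_Num ((A * B) $$ (i, j)) ((A * B0 + A0 * B) $$ (i, j))"
    by (rule dual_mat_index) (use assms ij in auto)
  thus "(dual_mat A A0 * dual_mat B B0) $$ (i, j) = dual_mat (A * B) (A * B0 + A0 * B) $$ (i, j)"
    using assms ij
    by (auto simp: dual_num_eq_iff scalar_prod_def dual_mat_index[of _ m k] dual_mat_index[of _ k n]
        sum.distrib)
qed (use assms in auto)

lemma dual_mat_minus:
  assumes "A \<in> carrier_mat m n" "A0 \<in> carrier_mat m n" "B \<in> carrier_mat m n" "B0 \<in> carrier_mat m n"
  shows "dual_mat A A0 - dual_mat B B0 = dual_mat (A - B) (A0 - B0)"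
  using assms
  by (intro eq_matI) (auto simp: dual_mat_def dual_num_eq_iff dual_unit_def)

lemma transpose_dual_mat:
  assumes "A \<in> carrier_mat m n" "A0 \<in> carrier_mat m n"
  shows "transpose_mat (dual_mat A A0) = dual_mat (transpose_mat A) (transpose_mat A0)"
  using assms
  by (intro eq_matI) (auto simp: dual_mat_def)

lemma dual_mat_one: "dual_mat (1\<^sub>m n) (0\<^sub>m n n) = 1\<^sub>m n"
  by (intro eq_matI) (auto simp: dual_mat_def dual_num_eq_iff dual_unit_def)

text \<open>For a DMPGI \<open>X + \<epsilon> X0\<close>, the infinitesimal part of the first
  Penrose equation reads \<open>A0 = A * X * A0 + (A * X0 + A0 * X) * A\<close>; hence
  \<open>P = X * A0\<close> and \<open>Q = A * X0 + A0 * X\<close>.\<close>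

lemma has_dmpgi_imp_decomp:
  assumes A: "A \<in> carrier_mat m n" and A0: "A0 \<in> carrier_mat m n" and "has_dmpgi (dual_mat A A0)"
  obtains P Q where "P \<in> carrier_mat n n" "Q \<in> carrier_mat m m" "A0 = A * P + Q * A"
proof -
  obtain Xh where Xh: "Xh \<in> carrier_mat n m" "dual_mat A A0 * Xh * dual_mat A A0 = dual_mat A A0"
    using assms by (auto simp: has_dmpgi_def is_dmpgi_def)
  obtain X X0 where X: "X \<in> carrier_mat n m" and X0: "X0 \<in> carrier_mat n m" and "Xh = dual_mat X X0"
    using dual_mat_cases[OF Xh(1)] .
  hence "dual_mat (A * X * A) (A * X * A0 + (A * X0 + A0 * X) * A) = dual_mat A A0"
    using Xh(2) dual_mat_mult[OF A A0 X X0]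
      dual_mat_mult[of "A * X" m m "A * X0 + A0 * X" A n A0] A A0 X by auto
  moreover have "A * X * A0 + (A * X0 + A0 * X) * A \<in> carrier_mat m n" "A * X * A \<in> carrier_mat m n"
    using A A0 X X0 by auto
  ultimately have "A0 = A * X * A0 + (A * X0 + A0 * X) * A"
    using dual_mat_eq_iff A A0 by metis
  hence "A0 = A * (X * A0) + (A * X0 + A0 * X) * A"
    by (simp only: assoc_mult_mat[OF A X A0])
  thus thesis using that[of "X * A0" "A * X0 + A0 * X"] A A0 X X0 by auto
qed

text \<open>If the Gram matrix kills v, then the squared length of \<open>L *\<^sub>v v\<close> is
  zero. Over the reals this forces \<open>L *\<^sub>v v\<close> to vanish, and the left inverse then
  gives v = 0.\<close>

lemma det_gram_nonzero:
  fixes L :: "real mat"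
  assumes L: "L \<in> carrier_mat m k" and L': "L' \<in> carrier_mat k m" and inv: "L' * L = 1\<^sub>m k"
  shows "det (transpose_mat L * L) \<noteq> 0"
proof
  have G: "transpose_mat L * L \<in> carrier_mat k k" using L by auto
  assume "det (transpose_mat L * L) = 0"
  then obtain v where v: "v \<in> carrier_vec k" "v \<noteq> 0\<^sub>v k" "(transpose_mat L * L) *\<^sub>v v = 0\<^sub>v k"
    using det_0_iff_vec_prod_zero_field[OF G] by auto
  have Lv: "L *\<^sub>v v \<in> carrier_vec m" using L v by auto
  have "(L *\<^sub>v v) \<bullet> (L *\<^sub>v v) = (transpose_mat L *\<^sub>v (L *\<^sub>v v)) \<bullet> v"
    using transpose_vec_mult_scalar[OF L v(1) Lv] by simp
  also have "transpose_mat L *\<^sub>v (L *\<^sub>v v) = 0\<^sub>v k"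
    using v L by (simp add: assoc_mult_mat_vec)
  finally have "(L *\<^sub>v v) \<bullet> (L *\<^sub>v v) = 0" using v by simp
  hence "L *\<^sub>v v = 0\<^sub>v m"
    using conjugate_square_eq_0_vec[OF Lv] by simp
  moreover have "L' *\<^sub>v 0\<^sub>v m = 0\<^sub>v k" using L' by (intro eq_vecI) auto
  ultimately have "(L' * L) *\<^sub>v v = 0\<^sub>v k" using L L' v by (simp add: assoc_mult_mat_vec)
  thus False using v inv by simp
qed

text \<open>With \<open>Lh = L + \<epsilon> Z\<close>, the Gram matrix of \<open>Lh\<close> has the
  invertible standard part \<open>G\<close> and is therefore invertible over the dual numbers. Then
  \<open>Y\<close> is its inverse times the transpose of \<open>Lh\<close>.\<close>

lemma dual_mat_obtain_left_inverse:
  assumes L: "L \<in> carrier_mat m k" and L': "L' \<in> carrier_mat k m" and inv: "L' * L = 1\<^sub>m k"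
    and Z: "Z \<in> carrier_mat m k"
  obtains Y where "Y \<in> carrier_mat k m" "Y * dual_mat L Z = 1\<^sub>m k"
    "transpose_mat (dual_mat L Z * Y) = dual_mat L Z * Y"
proof -
  define Lh where "Lh = dual_mat L Z"
  define G where "G = transpose_mat L * L"
  define G0 where "G0 = transpose_mat L * Z + transpose_mat Z * L"
  have cG: "G \<in> carrier_mat k k" and cG0: "G0 \<in> carrier_mat k k" and cL: "Lh \<in> carrier_mat m k"
    using L Z by (auto simp: G_def G0_def Lh_def)
  have G: "transpose_mat Lh * Lh = dual_mat G G0"
    using dual_mat_mult[of "transpose_mat L" k m "transpose_mat Z" L k Z] L Z
    by (auto simp: Lh_def transpose_dual_mat[OF L Z] G_def G0_def)
  obtain J where J: "J \<in> carrier_mat k k" "G * J = 1\<^sub>m k"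
    using det_nonzero_obtain_inverse[OF cG] det_gram_nonzero[OF L L' inv] by (auto simp: G_def)
  \<comment> \<open>The inverse of \<open>G + \<epsilon> G0\<close>: the geometric series for it
    stops after the first-order term because \<epsilon> squares to zero.\<close>
  define Jh where "Jh = dual_mat J (- (J * (G0 * J)))"
  have cJ: "Jh \<in> carrier_mat k k" using J cG0 by (auto simp: Jh_def)
  have "G * (- (J * (G0 * J))) + G0 * J = 0\<^sub>m k k"
  proof -
    have "G * (J * (G0 * J)) = G0 * J"
      using mult_mat_cancel_left[OF cG J, of "G0 * J" k] cG0 J by simp
    thus ?thesis using cG cG0 J by (simp add: uminus_l_inv_mat[of _ k k])
  qed
  hence GJ: "(transpose_mat Lh * Lh) * Jh = 1\<^sub>m k"
    unfolding G Jh_def using dual_mat_mult[OF cG cG0 J(1), of "- (J * (G0 * J))"] J cG0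
    by (simp add: dual_mat_one)
  have GT: "transpose_mat (transpose_mat Lh * Lh) = transpose_mat Lh * Lh"
    using transpose_mult[of "transpose_mat Lh" k m Lh k] cL by simp
  have JG: "transpose_mat Jh * (transpose_mat Lh * Lh) = 1\<^sub>m k"
    using transpose_mult[of "transpose_mat Lh * Lh" k k Jh k] cL cJ GT GJ by simp
  \<comment> \<open>\<open>Jh\<close> is a right inverse of the symmetric Gram matrix and its
    transpose is a left inverse, so the two coincide.\<close>
  have JT: "transpose_mat Jh = Jh"
    using assoc_mult_mat[of "transpose_mat Jh" k k "transpose_mat Lh * Lh" k Jh k] cL cJ GJ JG by simp
  show thesis
  proof (rule that[of "Jh * transpose_mat Lh"])
    show "Jh * transpose_mat Lh * dual_mat L Z = 1\<^sub>m k"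
      using JG cJ cL unfolding JT by (simp add: Lh_def[symmetric])
    have "transpose_mat (Lh * (Jh * transpose_mat Lh)) = Lh * (Jh * transpose_mat Lh)"
      using cJ cL JT transpose_mult[of Lh m k "Jh * transpose_mat Lh" m]
        transpose_mult[of Jh k k "transpose_mat Lh" m] by simp
    thus "transpose_mat (dual_mat L Z * (Jh * transpose_mat Lh)) = dual_mat L Z * (Jh * transpose_mat Lh)"
      by (simp add: Lh_def)
  qed (use cJ cL in auto)
qed

text \<open>The DMPGI is \<open>W * Y\<close>: the inner factors cancel, so the two products with
  \<open>L * T\<close> collapse to the symmetric matrices \<open>L * Y\<close> and
  \<open>W * T\<close>.\<close>

lemma has_dmpgi_mult:
  assumes L: "L \<in> carrier_mat m k" and Y: "Y \<in> carrier_mat k m" and YL: "Y * L = 1\<^sub>m k"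
    and LY: "transpose_mat (L * Y) = L * Y"
    and T: "T \<in> carrier_mat k n" and W: "W \<in> carrier_mat n k" and TW: "T * W = 1\<^sub>m k"
    and WT: "transpose_mat (W * T) = W * T"
  shows "has_dmpgi (L * T)"
proof -
  have 1: "L * T * (W * Y) = L * Y"
  proof -
    have "L * T * (W * Y) = L * (T * W * Y)" using assoc_mult_mat[OF L T mult_carrier_mat[OF W Y]] assoc_mult_mat[OF T W Y] by simp
    thus ?thesis using Y by (simp add: TW)
  qed
  have 2: "W * Y * (L * T) = W * T"
  proof -
    have "W * Y * (L * T) = W * (Y * L * T)" using assoc_mult_mat[OF W Y mult_carrier_mat[OF L T]] assoc_mult_mat[OF Y L T] by simp
    thus ?thesis using T by (simp add: YL)
  qed
  have 3: "L * Y * (L * T) = L * T"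
  proof -
    have "L * Y * (L * T) = L * (Y * L * T)" using assoc_mult_mat[OF L Y mult_carrier_mat[OF L T]] assoc_mult_mat[OF Y L T] by simp
    thus ?thesis using T by (simp add: YL)
  qed
  have 4: "W * T * (W * Y) = W * Y"
  proof -
    have "W * T * (W * Y) = W * (T * W * Y)" using assoc_mult_mat[OF W T mult_carrier_mat[OF W Y]] assoc_mult_mat[OF T W Y] by simp
    thus ?thesis using Y by (simp add: TW)
  qed
  have "is_dmpgi (L * T) (W * Y)"
    unfolding is_dmpgi_def 1 2 3 4 using L T W Y LY WT by auto
  thus ?thesis by (auto simp: has_dmpgi_def)
qed

text \<open>The existence criterion used for the converse direction. \<open>L'\<close> and
  \<open>T'\<close> witness that \<open>L\<close> has full column rank and \<open>T\<close> full row
  rank, which the dual factors \<open>L + \<epsilon> Z\<close> and \<open>T + \<epsilon> W\<close>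
  inherit.\<close>

lemma has_dmpgi_full_rank_factorization:
  assumes L: "L \<in> carrier_mat m k" and L': "L' \<in> carrier_mat k m" and LL: "L' * L = 1\<^sub>m k"
    and T: "T \<in> carrier_mat k n" and T': "T' \<in> carrier_mat n k" and TT: "T * T' = 1\<^sub>m k"
    and Z: "Z \<in> carrier_mat m k" and W: "W \<in> carrier_mat k n"
  shows "has_dmpgi (dual_mat (L * T) (L * W + Z * T))"
proof -
  obtain Y where Y: "Y \<in> carrier_mat k m" "Y * dual_mat L Z = 1\<^sub>m k"
    "transpose_mat (dual_mat L Z * Y) = dual_mat L Z * Y"
    using dual_mat_obtain_left_inverse[OF L L' LL Z] .
  let ?T = "dual_mat T W"
  \<comment> \<open>The right factor is handled through its transpose, for which the transpose of
    \<open>T'\<close> is a left inverse.\<close>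
  have "transpose_mat T' * transpose_mat T = 1\<^sub>m k"
    using transpose_mult[OF T T'] TT by simp
  then obtain X where X: "X \<in> carrier_mat k n" "X * transpose_mat ?T = 1\<^sub>m k"
    "transpose_mat (transpose_mat ?T * X) = transpose_mat ?T * X"
    using dual_mat_obtain_left_inverse[of "transpose_mat T" n k "transpose_mat T'" "transpose_mat W"]
      T T' W transpose_dual_mat[OF T W] by auto
  have cT: "?T \<in> carrier_mat k n" using W by auto
  have "?T * transpose_mat X = 1\<^sub>m k"
    using transpose_mult[of X k n "transpose_mat ?T" k] X cT by simp
  moreover have "transpose_mat (transpose_mat X * ?T) = transpose_mat X * ?T"
    using transpose_mult[of "transpose_mat ?T" n k X n] X cT by simp
  ultimately have "has_dmpgi (dual_mat L Z * ?T)"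
    using has_dmpgi_mult[OF dual_mat_carrier[OF Z] Y cT, of "transpose_mat X"] X by simp
  thus ?thesis by (simp add: dual_mat_mult[OF L Z T W])
qed

section \<open>Orthogonal triangularization\<close>

lemma real_orthogonal_one: "real_orthogonal n (1\<^sub>m n)"
  by (simp add: real_orthogonal_def)

lemma real_orthogonal_transpose: "real_orthogonal n Q \<Longrightarrow> real_orthogonal n (transpose_mat Q)"
  by (auto simp: real_orthogonal_def)

lemma real_orthogonal_mult:
  assumes "real_orthogonal n P" "real_orthogonal n Q"
  shows "real_orthogonal n (P * Q)"
proof -
  have P: "P \<in> carrier_mat n n" "transpose_mat P * P = 1\<^sub>m n" "P * transpose_mat P = 1\<^sub>m n"
    and Q: "Q \<in> carrier_mat n n" "transpose_mat Q * Q = 1\<^sub>m n" "Q * transpose_mat Q = 1\<^sub>m n"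
    using assms by (auto simp: real_orthogonal_def)
  have "transpose_mat (P * Q) * (P * Q) = transpose_mat Q * (transpose_mat P * (P * Q))"
    using P Q assoc_mult_mat[of "transpose_mat Q" n n "transpose_mat P" n "P * Q" n]
    by (simp add: transpose_mult[OF P(1) Q(1)])
  hence 1: "transpose_mat (P * Q) * (P * Q) = 1\<^sub>m n"
    using mult_mat_cancel_left[of "transpose_mat P" n n P Q n] P Q by simp
  have "P * Q * transpose_mat (P * Q) = P * (Q * (transpose_mat Q * transpose_mat P))"
    using P Q assoc_mult_mat[of P n n Q n "transpose_mat Q * transpose_mat P" n]
    by (simp add: transpose_mult[OF P(1) Q(1)])
  hence "P * Q * transpose_mat (P * Q) = 1\<^sub>m n"
    using mult_mat_cancel_left[of Q n n "transpose_mat Q" "transpose_mat P" n] P Q by simp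
  thus ?thesis using 1 P(1) Q(1) by (simp add: real_orthogonal_def)
qed

text \<open>Lets an orthogonal matrix act on all coordinates but the first, as the induction for
  triangularization requires.\<close>

lemma real_orthogonal_embed:
  assumes "real_orthogonal n Q"
  shows "real_orthogonal (1 + n) (four_block_mat (1\<^sub>m 1) (0\<^sub>m 1 n) (0\<^sub>m n 1) Q)" (is "real_orthogonal _ ?P")
proof -
  have Q: "Q \<in> carrier_mat n n" "transpose_mat Q * Q = 1\<^sub>m n" "Q * transpose_mat Q = 1\<^sub>m n"
    using assms by (auto simp: real_orthogonal_def)
  have T: "transpose_mat ?P = four_block_mat (1\<^sub>m 1) (0\<^sub>m 1 n) (0\<^sub>m n 1) (transpose_mat Q)"
    using transpose_four_block_mat[of "1\<^sub>m 1" 1 1 "0\<^sub>m 1 n" n "0\<^sub>m n 1" n Q] Q by simp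
  have mult: "four_block_mat (1\<^sub>m 1) (0\<^sub>m 1 n) (0\<^sub>m n 1) A * four_block_mat (1\<^sub>m 1) (0\<^sub>m 1 n) (0\<^sub>m n 1) B =
      four_block_mat (1\<^sub>m 1) (0\<^sub>m 1 n) (0\<^sub>m n 1) (A * B)"
    if "A \<in> carrier_mat n n" "B \<in> carrier_mat n n" for A B :: "real mat"
    using mult_four_block_mat[of "1\<^sub>m 1" 1 1 "0\<^sub>m 1 n" n "0\<^sub>m n 1" n A "1\<^sub>m 1" 1 "0\<^sub>m 1 n" n "0\<^sub>m n 1" B] that
    by simp
  show ?thesis
    unfolding real_orthogonal_def T
    using Q mult[of "transpose_mat Q" Q] mult[of Q "transpose_mat Q"] four_block_one_mat[of 1 n]
      four_block_carrier_mat[of "1\<^sub>m 1" 1 1 Q n n]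
    by (simp del: One_nat_def)
qed

text \<open>The Householder reflection in the direction of \<open>v - \<parallel>v\<parallel> e\<^sub>0\<close>; when this vector is zero, the junk
  value \<open>2 / 0 = 0\<close> makes it the identity, which is what is needed.\<close>

lemma real_orthogonal_annihilate:
  fixes v :: "real vec"
  assumes v: "v \<in> carrier_vec n" and n: "0 < n"
  obtains Q where "real_orthogonal n Q" "\<And>i. 0 < i \<Longrightarrow> i < n \<Longrightarrow> (Q *\<^sub>v v) $ i = 0"
proof -
  define a where "a = sqrt (\<Sum>i<n. v $ i * v $ i)"
  define u where "u i = v $ i - (if i = 0 then a else 0)" for i
  define s where "s = (\<Sum>i<n. u i * u i)"
  define c where "c = 2 / s"
  define q where "q i j = (if i = j then 1 else 0) - c * u i * u j" for i j
  define Q where "Q = mat n n (\<lambda>(i, j). q i j)"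
  have a2: "a * a = (\<Sum>i<n. v $ i * v $ i)"
    unfolding a_def by (simp add: sum_nonneg)
  have delta: "(\<Sum>i<n. (if i = 0 then a else 0) * f i) = a * f 0" for f :: "nat \<Rightarrow> real"
    using n by (subst sum.remove[of _ 0]) auto
  have uv: "(\<Sum>i<n. u i * v $ i) = a * a - a * v $ 0"
    unfolding u_def left_diff_distrib sum_subtractf delta a2 ..
  \<comment> \<open>As \<open>a\<close> is the length of \<open>v\<close>, the squared length
    \<open>s\<close> of \<open>u = v - a e_0\<close> is twice the scalar product of \<open>u\<close>
    and \<open>v\<close>. Hence the reflection sends \<open>v\<close> to
    \<open>v - u\<close>.\<close>
  have "s = (\<Sum>i<n. u i * v $ i) - (\<Sum>i<n. (if i = 0 then a else 0) * u i)"
    unfolding s_def u_def by (simp add: algebra_simps flip: sum_subtractf)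
  hence s: "s = 2 * (\<Sum>i<n. u i * v $ i)"
    unfolding delta uv by (simp add: u_def algebra_simps)
  \<comment> \<open>This also holds for \<open>s = 0\<close>, where \<open>c\<close> is 0.\<close>
  have cs: "c * (c * s) = 2 * c" by (simp add: c_def)
  have qq: "(\<Sum>l<n. q i l * q l j) = (if i = j then 1 else 0)" if ij: "i < n" "j < n" for i j
  proof -
    have "(\<Sum>l<n. q i l * q l j) = (\<Sum>l<n. (if l = i then (if i = j then 1 else 0) else 0)
        - (if l = i then c * u i * u j else 0) - (if l = j then c * u i * u j else 0)
        + c * u i * c * u j * (u l * u l))"
      by (intro sum.cong) (auto simp: q_def algebra_simps)
    also have "\<dots> = (if i = j then 1 else 0) - 2 * (c * u i * u j) + c * u i * c * u j * s"
      using ij by (simp add: sum.distrib sum_subtractf s_def sum_distrib_left)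
    also have "c * u i * c * u j * s = (c * (c * s)) * u i * u j" by (simp add: algebra_simps)
    finally show ?thesis unfolding cs by simp
  qed
  have cQ: "Q \<in> carrier_mat n n" by (simp add: Q_def)
  have QT: "transpose_mat Q = Q"
    by (intro eq_matI) (auto simp: Q_def q_def)
  have "Q * Q = 1\<^sub>m n"
    using qq by (intro eq_matI) (auto simp: Q_def scalar_prod_def atLeast0LessThan)
  hence "real_orthogonal n Q" using cQ by (simp add: real_orthogonal_def QT)
  moreover have "(Q *\<^sub>v v) $ i = 0" if i: "0 < i" "i < n" for i
  proof -
    have "(Q *\<^sub>v v) $ i = (\<Sum>l<n. q i l * v $ l)"
      using i v by (simp add: Q_def scalar_prod_def atLeast0LessThan)
    also have "\<dots> = (\<Sum>l<n. (if l = i then v $ i else 0) - c * u i * (u l * v $ l))"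
      by (intro sum.cong) (auto simp: q_def algebra_simps)
    also have "\<dots> = v $ i - c * u i * (\<Sum>l<n. u l * v $ l)"
      using i by (simp add: sum_subtractf sum_distrib_left)
    \<comment> \<open>For positive \<open>i\<close> the entries \<open>u i\<close> and
      \<open>v $ i\<close> agree. The second factor vanishes unless \<open>s = 0\<close>, and in
      that case \<open>u i\<close> does.\<close>
    also have "\<dots> = u i * (1 - c * s / 2)" using i s by (simp add: u_def algebra_simps)
    also have "\<dots> = 0"
    proof (cases "s = 0")
      case True
      hence "\<forall>l\<in>{..<n}. u l * u l = 0"
        using sum_nonneg_eq_0_iff[of "{..<n}" "\<lambda>l. u l * u l"] by (simp add: s_def)
      thus ?thesis using i by simp
    qed (simp add: c_def)
    finally show ?thesis .
  qed
  ultimately show thesis by (rule that)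
qed

text \<open>QR decomposition by induction on the number of rows: a reflection clears the first
  column below its top entry, and the induction hypothesis treats what remains after deleting the
  first row and column.\<close>

lemma real_orthogonal_triangularize:
  assumes "K \<in> carrier_mat m k"
  shows "\<exists>Q. real_orthogonal m Q \<and> (\<forall>i<m. \<forall>j<k. j < i \<longrightarrow> (Q * K) $$ (i, j) = 0)"
  using assms
proof (induction m arbitrary: k K)
  case 0
  show ?case using real_orthogonal_one[of 0] by auto
next
  case (Suc m)
  show ?case
  proof (cases "k = 0")
    case True
    thus ?thesis using real_orthogonal_one[of "Suc m"] by auto
  next
    case False
    obtain H where H: "real_orthogonal (Suc m) H" "\<And>i. 0 < i \<Longrightarrow> i < Suc m \<Longrightarrow> (H *\<^sub>v col K 0) $ i = 0"
      using real_orthogonal_annihilate[of "col K 0" "Suc m"] Suc.prems by (metis col_carrier_vec carrier_matD(1) carrier_matD(2) carrier_vecI col_dim zero_less_Suc)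
    have cH: "H \<in> carrier_mat (Suc m) (Suc m)" using H by (simp add: real_orthogonal_def)
    define K1 where "K1 = H * K"
    have cK1: "K1 \<in> carrier_mat (Suc m) k" using cH Suc.prems by (auto simp: K1_def)
    have K10: "K1 $$ (Suc i, 0) = 0" if "i < m" for i
      using H(2)[of "Suc i"] that False cH Suc.prems by (auto simp: K1_def)
    \<comment> \<open>\<open>K1\<close> without its first row and column; \<open>k\<close> is
      nonzero here, so \<open>k - 1\<close> does not truncate.\<close>
    define K2 where "K2 = mat m (k - 1) (\<lambda>(i, j). K1 $$ (Suc i, Suc j))"
    obtain Q where Q: "real_orthogonal m Q" "\<forall>i<m. \<forall>j<k - 1. j < i \<longrightarrow> (Q * K2) $$ (i, j) = 0"
      using Suc.IH[of K2 "k - 1"] by (auto simp: K2_def)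
    have cQ: "Q \<in> carrier_mat m m" using Q by (simp add: real_orthogonal_def)
    define P where "P = four_block_mat (1\<^sub>m 1) (0\<^sub>m 1 m) (0\<^sub>m m 1) Q"
    have cP: "P \<in> carrier_mat (Suc m) (Suc m)"
      using four_block_carrier_mat[of "1\<^sub>m 1" 1 1 Q m m] cQ by (simp add: P_def)
    have oP: "real_orthogonal (Suc m) P" using real_orthogonal_embed[OF Q(1)] by (simp add: P_def)
    have "(P * K1) $$ (i, j) = 0" if ij: "i < Suc m" "j < k" "j < i" for i j
    proof -
      obtain i' where i': "i = Suc i'" "i' < m" using ij by (cases i) auto
      \<comment> \<open>Below its first row \<open>P\<close> is zero in the first column, so only
        \<open>Q\<close> and the lower rows of \<open>K1\<close> enter.\<close>
      have "(P * K1) $$ (i, j) = (\<Sum>l<Suc m. P $$ (i, l) * K1 $$ (l, j))"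
        using ij cP cK1 by (simp add: scalar_prod_def atLeast0LessThan)
      also have "\<dots> = (\<Sum>l<m. Q $$ (i', l) * K1 $$ (Suc l, j))"
        using i' cQ by (subst sum.lessThan_Suc_shift) (simp add: P_def)
      also have "\<dots> = 0"
      proof (cases j)
        case 0
        thus ?thesis using K10 by simp
      next
        case (Suc j')
        have "(Q * K2) $$ (i', j') = 0" using Q(2) ij i' Suc by simp
        thus ?thesis using ij i' Suc cQ by (simp add: K2_def scalar_prod_def atLeast0LessThan)
      qed
      finally show ?thesis .
    qed
    moreover have "P * H * K = P * K1" using cP cH Suc.prems by (simp add: K1_def)
    moreover have "real_orthogonal (Suc m) (P * H)"
      by (intro real_orthogonal_mult oP H)
    ultimately show ?thesis by metis
  qed
qed

section \<open>Orthogonal block forms\<close>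

text \<open>Serves two proofs by contradiction: a singular diagonal block would let a matrix factor
  through too small a dimension.\<close>

lemma singular_mat_factorization:
  fixes A :: "real mat"
  assumes A: "A \<in> carrier_mat k k" and "det A = 0"
  obtains r P Q where "r < k" "P \<in> carrier_mat k r" "Q \<in> carrier_mat r k" "A = P * Q"
proof -
  have "mat_rank A \<noteq> k" "mat_rank A \<le> k"
    using vec_space.det_rank_iff[OF A] vec_space.rank_le_nc[OF A] assms by auto
  thus thesis using rank_factorization[OF A] that by (metis le_neq_implies_less)
qed

text \<open>A QR decomposition of the concatenation of \<open>LE\<close> and \<open>LG\<close>, of
  whose triangular factor just the block pattern is recorded. \<open>U\<close> is the transpose of
  the triangularizing matrix.\<close>

lemma orthogonal_block_triangularize:
  assumes LE: "LE \<in> carrier_mat m a" and LG: "LG \<in> carrier_mat m b" and m: "m = a + (b + c)"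
  obtains U A1 A2 A3 where "real_orthogonal m U"
    "A1 \<in> carrier_mat a a" "A2 \<in> carrier_mat a b" "A3 \<in> carrier_mat b b"
    "LE = U * (A1 @\<^sub>r 0\<^sub>m b a @\<^sub>r 0\<^sub>m c a)" "LG = U * (A2 @\<^sub>r A3 @\<^sub>r 0\<^sub>m c b)"
proof -
  obtain Q where Q: "real_orthogonal m Q"
    and tri: "\<forall>i<m. \<forall>j<a + b. j < i \<longrightarrow> (Q * (LE @\<^sub>c LG)) $$ (i, j) = 0"
    using real_orthogonal_triangularize[OF append_cols_carrier[OF LE LG]] by blast
  have cQ: "Q \<in> carrier_mat m m" and QQ: "transpose_mat Q * Q = 1\<^sub>m m"
    using Q by (auto simp: real_orthogonal_def)
  have cE: "Q * LE \<in> carrier_mat m a" and cG: "Q * LG \<in> carrier_mat m b" using cQ LE LG by auto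
  have QK: "Q * (LE @\<^sub>c LG) = (Q * LE) @\<^sub>c (Q * LG)" by (rule mult_append_cols[OF LE LG cQ])
  have zE: "(Q * LE) $$ (i, j) = 0" if "i < m" "j < a" "j < i" for i j
    using tri that append_cols_index[OF cE cG, of i j] by (simp add: QK)
  \<comment> \<open>Column \<open>j\<close> of \<open>LG\<close> is column \<open>a + j\<close> of
    the concatenation, which shifts the diagonal by \<open>a\<close>.\<close>
  have zG: "(Q * LG) $$ (i, j) = 0" if "i < m" "j < b" "a + j < i" for i j
    using tri[rule_format, of i "a + j"] that append_cols_index[OF cE cG, of i "a + j"] by (simp add: QK)
  obtain A1 X Y where A1: "A1 \<in> carrier_mat a a" and X: "X \<in> carrier_mat b a"
    and Y: "Y \<in> carrier_mat c a" and E: "Q * LE = A1 @\<^sub>r X @\<^sub>r Y"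
    using append_rows_split3[of "Q * LE" a b c a] cE m by auto
  obtain A2 A3 Z where A2: "A2 \<in> carrier_mat a b" and A3: "A3 \<in> carrier_mat b b"
    and Z: "Z \<in> carrier_mat c b" and G: "Q * LG = A2 @\<^sub>r A3 @\<^sub>r Z"
    using append_rows_split3[of "Q * LG" a b c b] cG m by auto
  have X0: "X = 0\<^sub>m b a"
  proof (rule eq_matI)
    fix i j assume "i < dim_row (0\<^sub>m b a :: real mat)" "j < dim_col (0\<^sub>m b a :: real mat)"
    thus "X $$ (i, j) = 0\<^sub>m b a $$ (i, j)"
      using zE[of "a + i" j] m append_rows_index[OF A1 carrier_append_rows[OF X Y], of "a + i" j]
        append_rows_index[OF X Y, of i j] by (simp add: E)
  qed (use X in auto)
  have Y0: "Y = 0\<^sub>m c a"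
  proof (rule eq_matI)
    fix i j assume "i < dim_row (0\<^sub>m c a :: real mat)" "j < dim_col (0\<^sub>m c a :: real mat)"
    thus "Y $$ (i, j) = 0\<^sub>m c a $$ (i, j)"
      using zE[of "a + (b + i)" j] m append_rows_index[OF A1 carrier_append_rows[OF X Y], of "a + (b + i)" j]
        append_rows_index[OF X Y, of "b + i" j] by (simp add: E)
  qed (use Y in auto)
  have Z0: "Z = 0\<^sub>m c b"
  proof (rule eq_matI)
    fix i j assume "i < dim_row (0\<^sub>m c b :: real mat)" "j < dim_col (0\<^sub>m c b :: real mat)"
    thus "Z $$ (i, j) = 0\<^sub>m c b $$ (i, j)"
      using zG[of "a + (b + i)" j] m append_rows_index[OF A2 carrier_append_rows[OF A3 Z], of "a + (b + i)" j]
        append_rows_index[OF A3 Z, of "b + i" j] by (simp add: G)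
  qed (use Z in auto)
  have "LE = transpose_mat Q * (Q * LE)" "LG = transpose_mat Q * (Q * LG)"
    using mult_mat_cancel_left[of "transpose_mat Q" m m Q] cQ QQ LE LG by auto
  thus thesis
    using that[OF real_orthogonal_transpose[OF Q] A1 A2 A3] by (simp add: E G X0 Y0 Z0)
qed

text \<open>If \<open>A1\<close> were singular, \<open>LE * TE\<close> would factor through fewer
  than \<open>a\<close> dimensions. If \<open>A3\<close> were singular, the sum would split into two
  products whose inner dimensions add up to less than \<open>a + b\<close>.\<close>

lemma rank_additive_orthogonal_form:
  assumes LE: "LE \<in> carrier_mat m a" and TE: "TE \<in> carrier_mat a n"
    and LG: "LG \<in> carrier_mat m b" and TG: "TG \<in> carrier_mat b n"
    and rE: "mat_rank (LE * TE) = a" and rF: "mat_rank (LE * TE + LG * TG) = a + b"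
    and m: "m = a + (b + c)"
  obtains U A1 A2 A3 where "real_orthogonal m U"
    "A1 \<in> carrier_mat a a" "det A1 \<noteq> 0" "A2 \<in> carrier_mat a b" "A3 \<in> carrier_mat b b" "det A3 \<noteq> 0"
    "LE = U * (A1 @\<^sub>r 0\<^sub>m b a @\<^sub>r 0\<^sub>m c a)" "LG = U * (A2 @\<^sub>r A3 @\<^sub>r 0\<^sub>m c b)"
proof -
  obtain U A1 A2 A3 where U: "real_orthogonal m U"
    and A: "A1 \<in> carrier_mat a a" "A2 \<in> carrier_mat a b" "A3 \<in> carrier_mat b b"
    and eqE: "LE = U * (A1 @\<^sub>r 0\<^sub>m b a @\<^sub>r 0\<^sub>m c a)" and eqG: "LG = U * (A2 @\<^sub>r A3 @\<^sub>r 0\<^sub>m c b)"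
    using orthogonal_block_triangularize[OF LE LG m] .
  have cU: "U \<in> carrier_mat m m" using U by (simp add: real_orthogonal_def)
  have "det A1 \<noteq> 0"
  proof
    assume "det A1 = 0"
    then obtain r P Q where r: "r < a" and P: "P \<in> carrier_mat a r" and Q: "Q \<in> carrier_mat r a"
      and A1: "A1 = P * Q"
      using singular_mat_factorization[OF A(1)] by metis
    define J where "J = P @\<^sub>r 0\<^sub>m b r @\<^sub>r 0\<^sub>m c r"
    have cJ: "J \<in> carrier_mat m r" using append_rows3_carrier[OF P, of "0\<^sub>m b r" b "0\<^sub>m c r" c] m by (simp add: J_def)
    have "LE = U * (J * Q)"
      unfolding eqE A1 J_def using append_rows3_mult[OF P, of "0\<^sub>m b r" b "0\<^sub>m c r" c Q a] Q by simp
    hence "LE * TE = (U * J) * (Q * TE)"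
      using assoc_mult_mat[OF cU cJ Q] assoc_mult_mat[OF mult_carrier_mat[OF cU cJ] Q TE] by metis
    hence "mat_rank (LE * TE) \<le> r"
      using rank_mult_le_inner[of "U * J" m r "Q * TE" n] cU cJ Q TE by simp
    thus False using r rE by simp
  qed
  moreover have "det A3 \<noteq> 0"
  proof
    assume "det A3 = 0"
    then obtain r P Q where r: "r < b" and P: "P \<in> carrier_mat b r" and Q: "Q \<in> carrier_mat r b"
      and A3: "A3 = P * Q"
      using singular_mat_factorization[OF A(3)] by metis
    \<comment> \<open>The columns of \<open>J\<close> span the first \<open>a\<close> coordinates,
      and \<open>J'\<close> places \<open>P\<close> into the middle \<open>b\<close>. So the columns
      of \<open>LE\<close> are combinations of those of \<open>U * J\<close>, and the columns of
      \<open>LG\<close> of those of \<open>U * J\<close> and \<open>U * J'\<close>.\<close>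
    define J where "J = 1\<^sub>m a @\<^sub>r 0\<^sub>m b a @\<^sub>r (0\<^sub>m c a :: real mat)"
    define J' where "J' = 0\<^sub>m a r @\<^sub>r P @\<^sub>r 0\<^sub>m c r"
    have cJ: "J \<in> carrier_mat m a"
      using append_rows3_carrier[of "1\<^sub>m a" a a "0\<^sub>m b a" b "0\<^sub>m c a" c] m by (simp add: J_def)
    have cJ': "J' \<in> carrier_mat m r"
      using append_rows3_carrier[of "0\<^sub>m a r" a r P b "0\<^sub>m c r" c] m P by (simp add: J'_def)
    have E: "LE = (U * J) * A1"
      using append_rows3_mult[of "1\<^sub>m a" a a "0\<^sub>m b a" b "0\<^sub>m c a" c A1 a] A
        assoc_mult_mat[OF cU cJ A(1)] by (simp add: eqE J_def)
    have "J * A2 + J' * Q = A2 @\<^sub>r A3 @\<^sub>r 0\<^sub>m c b"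
      using append_rows3_mult[of "1\<^sub>m a" a a "0\<^sub>m b a" b "0\<^sub>m c a" c A2 b]
        append_rows3_mult[of "0\<^sub>m a r" a r P b "0\<^sub>m c r" c Q b]
        append_rows3_add[of A2 a b "0\<^sub>m b b" b "0\<^sub>m c b" c "0\<^sub>m a b" A3 "0\<^sub>m c b"] A P Q
      by (simp add: J_def J'_def A3[symmetric])
    hence G: "LG = (U * J) * A2 + (U * J') * Q"
      using mult_add_distrib_mat[of U m m "J * A2" b "J' * Q"] cU cJ cJ' A Q
        assoc_mult_mat[OF cU cJ A(2)] assoc_mult_mat[OF cU cJ' Q] by (simp add: eqG)
    have sum: "LE * TE + LG * TG = (U * J) * (A1 * TE + A2 * TG) + (U * J') * (Q * TG)"
    proof -
      have cs: "U * J \<in> carrier_mat m a" "U * J' \<in> carrier_mat m r" using cU cJ cJ' by auto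
      have "LG * TG = (U * J) * (A2 * TG) + (U * J') * (Q * TG)"
        using add_mult_distrib_mat[of "(U * J) * A2" m b "(U * J') * Q" TG n] cs A Q TG
          assoc_mult_mat[OF cs(1) A(2) TG] assoc_mult_mat[OF cs(2) Q TG] unfolding G by simp
      moreover have "LE * TE = (U * J) * (A1 * TE)"
        unfolding E by (rule assoc_mult_mat[OF cs(1) A(1) TE])
      moreover have "(U * J) * (A1 * TE + A2 * TG) = (U * J) * (A1 * TE) + (U * J) * (A2 * TG)"
        using cs A TE TG by (intro mult_add_distrib_mat) auto
      ultimately show ?thesis
        using cs A Q TE TG by (simp add: assoc_add_mat[of _ m n])
    qed
    have "mat_rank ((U * J) * (A1 * TE + A2 * TG)) \<le> a"
      using rank_mult_le_inner[of "U * J" m a "A1 * TE + A2 * TG" n] cU cJ A TE TG by simp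
    moreover have "mat_rank ((U * J') * (Q * TG)) \<le> r"
      using rank_mult_le_inner[of "U * J'" m r "Q * TG" n] cU cJ' Q TG by simp
    moreover have "(U * J) * (A1 * TE + A2 * TG) \<in> carrier_mat m n" "(U * J') * (Q * TG) \<in> carrier_mat m n"
      using cU cJ cJ' A Q TE TG by auto
    note rank_add_le[OF this]
    ultimately have "mat_rank (LE * TE + LG * TG) \<le> a + r"
      unfolding sum by linarith
    thus False using r rF by simp
  qed
  ultimately show thesis using that[OF U A(1) _ A(2,3) _ eqE eqG] by blast
qed

text \<open>Reads off an infinitesimal part: for \<open>X = U * L * (T * transpose_mat V)\<close>,
  the decomposition \<open>X * P + Q * X\<close> becomes \<open>L * W + Z * T\<close> between
  \<open>U\<close> and the transpose of \<open>V\<close>. It is applied to \<open>E\<close> with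
  \<open>k = a\<close> and to \<open>F - E\<close> with \<open>k = b\<close>.\<close>

lemma has_dmpgi_imp_block_form:
  assumes U: "real_orthogonal m U" and V: "real_orthogonal n V"
    and m: "m = r1 + (r2 + r3)" and n: "n = c1 + (c2 + c3)"
    and L: "L1 \<in> carrier_mat r1 k" "L2 \<in> carrier_mat r2 k" "L3 \<in> carrier_mat r3 k"
    and T: "T1 \<in> carrier_mat k c1" "T2 \<in> carrier_mat k c2" "T3 \<in> carrier_mat k c3"
    and X0: "X0 \<in> carrier_mat m n"
    and X: "X = U * (L1 @\<^sub>r L2 @\<^sub>r L3) * ((T1 @\<^sub>c T2 @\<^sub>c T3) * transpose_mat V)"
    and dmpgi: "has_dmpgi (dual_mat X X0)"
  obtains W1 W2 W3 Z1 Z2 Z3 where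
    "W1 \<in> carrier_mat k c1" "W2 \<in> carrier_mat k c2" "W3 \<in> carrier_mat k c3"
    "Z1 \<in> carrier_mat r1 k" "Z2 \<in> carrier_mat r2 k" "Z3 \<in> carrier_mat r3 k"
    "X0 = U * block3_mat
       (L1 * W1 + Z1 * T1) (L1 * W2 + Z1 * T2) (L1 * W3 + Z1 * T3)
       (L2 * W1 + Z2 * T1) (L2 * W2 + Z2 * T2) (L2 * W3 + Z2 * T3)
       (L3 * W1 + Z3 * T1) (L3 * W2 + Z3 * T2) (L3 * W3 + Z3 * T3) * transpose_mat V"
proof -
  have cU: "U \<in> carrier_mat m m" and UU: "U * transpose_mat U = 1\<^sub>m m"
    and cV: "V \<in> carrier_mat n n" and VV: "V * transpose_mat V = 1\<^sub>m n"
    using U V by (auto simp: real_orthogonal_def)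
  define L where "L = L1 @\<^sub>r L2 @\<^sub>r L3"
  define T where "T = T1 @\<^sub>c T2 @\<^sub>c T3"
  have cL: "L \<in> carrier_mat m k" using append_rows3_carrier[OF L] by (simp add: L_def m)
  have cT: "T \<in> carrier_mat k n" using append_cols3_carrier[OF T] by (simp add: T_def n)
  have cVT: "transpose_mat V \<in> carrier_mat n n" and cUT: "transpose_mat U \<in> carrier_mat m m"
    using cU cV by auto
  note cUL = mult_carrier_mat[OF cU cL] and cTV = mult_carrier_mat[OF cT cVT]
  have X: "X = (U * L) * (T * transpose_mat V)" by (simp add: X L_def T_def)
  have cX: "X \<in> carrier_mat m n" using cUL cTV unfolding X by (rule mult_carrier_mat)
  obtain P Q where P: "P \<in> carrier_mat n n" and Q: "Q \<in> carrier_mat m m" and eq: "X0 = X * P + Q * X"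
    using has_dmpgi_imp_decomp[OF cX X0 dmpgi] .
  \<comment> \<open>Chosen so that conjugating \<open>L * W\<close> and \<open>Z * T\<close> by the
    orthogonal factors returns \<open>X * P\<close> and \<open>Q * X\<close>.\<close>
  define W where "W = T * transpose_mat V * P * V"
  define Z where "Z = transpose_mat U * (Q * (U * L))"
  have cW: "W \<in> carrier_mat k n" unfolding W_def by (rule mult_carrier_mat[OF mult_carrier_mat[OF cTV P] cV])
  have cZ: "Z \<in> carrier_mat m k" using cUT cU Q cL by (simp add: Z_def)
  have "X * P = U * (L * W) * transpose_mat V"
  proof -
    have "W * transpose_mat V = T * transpose_mat V * P * (V * transpose_mat V)"
      unfolding W_def by (rule assoc_mult_mat[OF mult_carrier_mat[OF cTV P] cV cVT])
    hence WV: "W * transpose_mat V = T * transpose_mat V * P"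
      unfolding VV right_mult_one_mat[OF mult_carrier_mat[OF cTV P]] .
    have "X * P = (U * L) * (W * transpose_mat V)"
      unfolding X WV by (rule assoc_mult_mat[OF cUL cTV P])
    also have "\<dots> = U * L * W * transpose_mat V" by (rule assoc_mult_mat[OF cUL cW cVT, symmetric])
    also have "U * L * W = U * (L * W)" by (rule assoc_mult_mat[OF cU cL cW])
    finally show ?thesis .
  qed
  moreover have "Q * X = U * (Z * T) * transpose_mat V"
  proof -
    have "U * Z = Q * (U * L)"
      unfolding Z_def by (rule mult_mat_cancel_left[OF cU cUT UU mult_carrier_mat[OF Q cUL]])
    hence "Q * X = U * Z * (T * transpose_mat V)"
      unfolding X using assoc_mult_mat[OF Q cUL cTV] by simp
    also have "\<dots> = U * Z * T * transpose_mat V"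
      by (rule assoc_mult_mat[OF mult_carrier_mat[OF cU cZ] cT cVT, symmetric])
    also have "U * Z * T = U * (Z * T)" by (rule assoc_mult_mat[OF cU cZ cT])
    finally show ?thesis .
  qed
  ultimately have "X0 = U * (L * W) * transpose_mat V + U * (Z * T) * transpose_mat V"
    unfolding eq by simp
  also have "\<dots> = (U * (L * W) + U * (Z * T)) * transpose_mat V"
    by (rule add_mult_distrib_mat[symmetric]) (use cU cL cW cZ cT cVT in auto)
  also have "U * (L * W) + U * (Z * T) = U * (L * W + Z * T)"
    by (rule mult_add_distrib_mat[symmetric]) (use cU cL cW cZ cT in auto)
  finally have X0: "X0 = U * (L * W + Z * T) * transpose_mat V" .
  obtain W1 W2 W3 where W: "W1 \<in> carrier_mat k c1" "W2 \<in> carrier_mat k c2" "W3 \<in> carrier_mat k c3"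
    and eqW: "W = W1 @\<^sub>c W2 @\<^sub>c W3"
    using append_cols_split3[of W k c1 c2 c3] cW n by auto
  obtain Z1 Z2 Z3 where Z: "Z1 \<in> carrier_mat r1 k" "Z2 \<in> carrier_mat r2 k" "Z3 \<in> carrier_mat r3 k"
    and eqZ: "Z = Z1 @\<^sub>r Z2 @\<^sub>r Z3"
    using append_rows_split3[of Z r1 r2 r3 k] cZ m by auto
  show thesis
    using X0 unfolding L_def T_def eqW eqZ append_rows3_mult_append_cols3[OF L W]
      append_rows3_mult_append_cols3[OF Z T]
    by (subst (asm) block3_mat_add) (use L T W Z that in auto)
qed

section \<open>Algebra of the block entries and of conjugated block matrices\<close>

lemma invertible_mat_iff_det:
  fixes A :: "'a :: field mat"
  assumes A: "A \<in> carrier_mat n n"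
  shows "invertible_mat A \<longleftrightarrow> det A \<noteq> 0"
proof
  assume "invertible_mat A"
  then obtain B where B: "A * B = 1\<^sub>m n" "B * A = 1\<^sub>m (dim_row B)"
    using A by (auto simp: invertible_mat_def inverts_mat_def)
  have "B \<in> carrier_mat n n"
    using A B by (metis carrier_matD(2) carrier_matI index_mult_mat(2) index_mult_mat(3) index_one_mat(3))
  hence "det A * det B = 1" using det_mult[OF A] B(1) by (metis det_one)
  thus "det A \<noteq> 0" by auto
next
  assume "det A \<noteq> 0"
  then obtain B where "B \<in> carrier_mat n n" "A * B = 1\<^sub>m n" "B * A = 1\<^sub>m n"
    using det_nonzero_obtain_inverse[OF A] by metis
  thus "invertible_mat A" using A by (auto simp: invertible_mat_def inverts_mat_def)
qed

text \<open>Settles the top left infinitesimal block of \<open>F\<close>. The products in the roles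
  of \<open>R * M\<close> and \<open>N * S\<close> contain the surplus terms
  \<open>R * (Z2 * C2)\<close> and \<open>A2 * (W2 * S)\<close>, whose sum is what
  \<open>R * F5 * S\<close> subtracts.\<close>

lemma dual_minus_block_identity:
  fixes E1 R M N S F5 :: "real mat"
  assumes c: "E1 \<in> carrier_mat a a" "A2 \<in> carrier_mat a b" "A3 \<in> carrier_mat b b"
    "C2 \<in> carrier_mat b a" "C3 \<in> carrier_mat b b"
    "W1 \<in> carrier_mat b a" "W2 \<in> carrier_mat b b"
    "Z1 \<in> carrier_mat a b" "Z2 \<in> carrier_mat b b"
    "R \<in> carrier_mat a b" "S \<in> carrier_mat b a"
    and RA: "R * A3 = A2" and CS: "C3 * S = C2"
  shows "E1 + R * (A3 * W1 + Z2 * C2) + (A2 * W2 + Z1 * C3) * S - R * (A3 * W2 + Z2 * C3) * S =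
    E1 + (A2 * W1 + Z1 * C2)"
proof -
  have 1: "R * (A3 * W1 + Z2 * C2) = A2 * W1 + R * (Z2 * C2)"
    using mult_add_distrib_mat[of R a b "A3 * W1" a "Z2 * C2"] assoc_mult_mat[of R a b A3 b W1 a] c
    by (simp add: RA)
  have 2: "(A2 * W2 + Z1 * C3) * S = A2 * (W2 * S) + Z1 * C2"
    using add_mult_distrib_mat[of "A2 * W2" a b "Z1 * C3" S a] c
      assoc_mult_mat[of A2 a b W2 b S a] assoc_mult_mat[of Z1 a b C3 b S a]
    by (simp add: CS)
  have 3: "R * (A3 * W2 + Z2 * C3) * S = A2 * (W2 * S) + R * (Z2 * C2)"
  proof -
    have "R * (A3 * W2 + Z2 * C3) * S = (A2 * W2 + R * (Z2 * C3)) * S"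
      using mult_add_distrib_mat[of R a b "A3 * W2" b "Z2 * C3"] assoc_mult_mat[of R a b A3 b W2 b] c
      by (simp add: RA)
    also have "\<dots> = A2 * W2 * S + R * (Z2 * C3) * S"
      by (rule add_mult_distrib_mat) (use c in auto)
    also have "R * (Z2 * C3) * S = R * (Z2 * (C3 * S))"
      using assoc_mult_mat[of R a b "Z2 * C3" b S a] assoc_mult_mat[of Z2 b b C3 b S a] c by simp
    finally show ?thesis using assoc_mult_mat[of A2 a b W2 b S a] c by (simp add: CS)
  qed
  have cs: "A2 * W1 \<in> carrier_mat a a" "R * (Z2 * C2) \<in> carrier_mat a a"
    "A2 * (W2 * S) \<in> carrier_mat a a" "Z1 * C2 \<in> carrier_mat a a"
    using c by auto
  \<comment> \<open>Once all products are expanded, a purely additive identity remains, which holds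
    entrywise.\<close>
  have "E + (X + Y) + (P + Q) - (P + Y) = E + (X + Q)"
    if "E \<in> carrier_mat a a" "X \<in> carrier_mat a a" "Y \<in> carrier_mat a a" "P \<in> carrier_mat a a"
      "Q \<in> carrier_mat a a" for E X Y P Q :: "real mat"
    using that by (intro eq_matI) auto
  from this[OF c(1) cs] show ?thesis unfolding 1 2 3 .
qed

lemma conj_add:
  fixes U X Y W :: "real mat"
  assumes "U \<in> carrier_mat m k" "X \<in> carrier_mat k l" "Y \<in> carrier_mat k l" "W \<in> carrier_mat l n"
  shows "U * (X + Y) * W = U * X * W + U * Y * W"
  using mult_add_distrib_mat[OF assms(1-3)] add_mult_distrib_mat[of "U * X" m l "U * Y" W n] assms
  by auto

lemma conj_block3_add:
  assumes "U \<in> carrier_mat m (r1 + (r2 + r3))" "W \<in> carrier_mat (c1 + (c2 + c3)) n"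
    and A: "A11 \<in> carrier_mat r1 c1" "A12 \<in> carrier_mat r1 c2" "A13 \<in> carrier_mat r1 c3"
      "A21 \<in> carrier_mat r2 c1" "A22 \<in> carrier_mat r2 c2" "A23 \<in> carrier_mat r2 c3"
      "A31 \<in> carrier_mat r3 c1" "A32 \<in> carrier_mat r3 c2" "A33 \<in> carrier_mat r3 c3"
    and B: "B11 \<in> carrier_mat r1 c1" "B12 \<in> carrier_mat r1 c2" "B13 \<in> carrier_mat r1 c3"
      "B21 \<in> carrier_mat r2 c1" "B22 \<in> carrier_mat r2 c2" "B23 \<in> carrier_mat r2 c3"
      "B31 \<in> carrier_mat r3 c1" "B32 \<in> carrier_mat r3 c2" "B33 \<in> carrier_mat r3 c3"
  shows "U * block3_mat A11 A12 A13 A21 A22 A23 A31 A32 A33 * W +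
      U * block3_mat B11 B12 B13 B21 B22 B23 B31 B32 B33 * W =
    U * block3_mat (A11 + B11) (A12 + B12) (A13 + B13) (A21 + B21) (A22 + B22) (A23 + B23)
      (A31 + B31) (A32 + B32) (A33 + B33) * W"
  unfolding block3_mat_add[OF A B, symmetric]
  by (rule conj_add[OF assms(1) block3_mat_carrier[OF A] block3_mat_carrier[OF B] assms(2), symmetric])

lemma conj_mult_block3:
  assumes U: "U \<in> carrier_mat m (r1 + (r2 + r3))" and V: "V \<in> carrier_mat (c1 + (c2 + c3)) n"
    and L: "L1 \<in> carrier_mat r1 k" "L2 \<in> carrier_mat r2 k" "L3 \<in> carrier_mat r3 k"
    and T: "T1 \<in> carrier_mat k c1" "T2 \<in> carrier_mat k c2" "T3 \<in> carrier_mat k c3"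
  shows "U * (L1 @\<^sub>r L2 @\<^sub>r L3) * ((T1 @\<^sub>c T2 @\<^sub>c T3) * V) =
    U * block3_mat (L1 * T1) (L1 * T2) (L1 * T3) (L2 * T1) (L2 * T2) (L2 * T3) (L3 * T1) (L3 * T2) (L3 * T3) * V"
proof -
  note cL = append_rows3_carrier[OF L] and cT = append_cols3_carrier[OF T]
  show ?thesis
    unfolding append_rows3_mult_append_cols3[OF L T, symmetric]
    using assoc_mult_mat[OF mult_carrier_mat[OF U cL] cT V] assoc_mult_mat[OF U cL cT] by simp
qed

text \<open>Here \<open>X\<close> and \<open>X0\<close> are the two parts of the difference of the
  block forms of \<open>F\<close> and \<open>E\<close>. A full rank factorization through dimension
  \<open>b\<close> gives both the rank bound and the DMPGI.\<close>

lemma orthogonal_block_difference: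
  assumes U: "real_orthogonal m U" and V: "real_orthogonal n V"
    and m: "m = a + (b + c)" and n: "n = a + (b + d)"
    and D: "D \<in> carrier_mat b b" "invertible_mat D"
    and R: "R \<in> carrier_mat a b" and S: "S \<in> carrier_mat b a"
    and M: "M \<in> carrier_mat b a" and N: "N \<in> carrier_mat a b"
    and F5: "F5 \<in> carrier_mat b b" and F6: "F6 \<in> carrier_mat b d" and F8: "F8 \<in> carrier_mat c b"
  defines "X \<equiv> U * block3_mat (R * D * S) (R * D) (0\<^sub>m a d) (D * S) D (0\<^sub>m b d)
      (0\<^sub>m c a) (0\<^sub>m c b) (0\<^sub>m c d) * transpose_mat V"
    and "X0 \<equiv> U * block3_mat (R * M + (N - R * F5) * S) N (R * F6) M F5 F6
      (F8 * S) F8 (0\<^sub>m c d) * transpose_mat V"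
  shows "mat_rank X \<le> b" and "has_dmpgi (dual_mat X X0)"
proof -
  have cU: "U \<in> carrier_mat m m" and cUT: "transpose_mat U \<in> carrier_mat m m"
    and UU: "transpose_mat U * U = 1\<^sub>m m"
    and cV: "V \<in> carrier_mat n n" and cVT: "transpose_mat V \<in> carrier_mat n n"
    and VV: "transpose_mat V * V = 1\<^sub>m n"
    using U V by (auto simp: real_orthogonal_def)
  obtain D' where D': "D' \<in> carrier_mat b b" "D * D' = 1\<^sub>m b" "D' * D = 1\<^sub>m b"
    using det_nonzero_obtain_inverse[OF D(1)] D(2) invertible_mat_iff_det[OF D(1)] by metis
  have RD: "R * D \<in> carrier_mat a b" using R D by auto
  have z: "0\<^sub>m i j \<in> carrier_mat i j" and o: "1\<^sub>m i \<in> carrier_mat i i" for i j by simp_all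
  \<comment> \<open>Up to \<open>U\<close> and \<open>V\<close>, \<open>X\<close> is
    \<open>L * T\<close>. The invertible middle blocks \<open>D\<close> and
    \<open>1\<^sub>m b\<close> of the two factors give the one-sided inverses \<open>L'\<close> and
    \<open>T'\<close>.\<close>
  define L where "L = R * D @\<^sub>r D @\<^sub>r 0\<^sub>m c b"
  define L' where "L' = 0\<^sub>m b a @\<^sub>c D' @\<^sub>c 0\<^sub>m b c"
  define T where "T = S @\<^sub>c 1\<^sub>m b @\<^sub>c 0\<^sub>m b d"
  define T' where "T' = 0\<^sub>m a b @\<^sub>r 1\<^sub>m b @\<^sub>r (0\<^sub>m d b :: real mat)"
  have cL: "L \<in> carrier_mat m b" unfolding L_def m by (rule append_rows3_carrier[OF RD D(1) z])
  have cL': "L' \<in> carrier_mat b m" unfolding L'_def m by (rule append_cols3_carrier[OF z D'(1) z])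
  have cT: "T \<in> carrier_mat b n" unfolding T_def n by (rule append_cols3_carrier[OF S o z])
  have cT': "T' \<in> carrier_mat n b" unfolding T'_def n by (rule append_rows3_carrier[OF z o z])
  have LL: "L' * L = 1\<^sub>m b"
    unfolding L_def L'_def append_cols3_mult_append_rows3[OF z D'(1) z RD D(1) z] using D' by (simp add: left_mult_zero_mat[OF RD])
  have TT: "T * T' = 1\<^sub>m b"
    unfolding T_def T'_def append_cols3_mult_append_rows3[OF S o z z o z] using S by simp
  have X: "X = (U * L) * (T * transpose_mat V)"
    unfolding X_def L_def T_def conj_mult_block3[OF cU[unfolded m] cVT[unfolded n] RD D(1) z S o z, folded m n]
    using D R S by simp
  show "mat_rank X \<le> b"
    unfolding X by (rule rank_mult_le_inner[OF mult_carrier_mat[OF cU cL] mult_carrier_mat[OF cT cVT]])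
  have W: "D' * M \<in> carrier_mat b a" "D' * F5 \<in> carrier_mat b b" "D' * F6 \<in> carrier_mat b d"
    using D' M F5 F6 by auto
  have Z: "N - R * F5 \<in> carrier_mat a b" using R F5 by auto
  \<comment> \<open>\<open>W\<close> makes the middle block row of \<open>L * W\<close> equal to
    \<open>M\<close>, \<open>F5\<close>, \<open>F6\<close>. Its first block row is then
    \<open>R\<close> times these, so \<open>Z\<close> has to supply \<open>N - R * F5\<close> there
    and \<open>F8\<close> in the last one.\<close>
  define W where "W = ((D' * M) @\<^sub>c (D' * F5) @\<^sub>c (D' * F6)) * transpose_mat V"
  define Z where "Z = U * ((N - R * F5) @\<^sub>r 0\<^sub>m b b @\<^sub>r F8)"
  have cW: "W \<in> carrier_mat b n"
    unfolding W_def by (rule mult_carrier_mat[OF append_cols3_carrier[OF W(1-3), folded n] cVT])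
  have cZ: "Z \<in> carrier_mat m b"
    unfolding Z_def by (rule mult_carrier_mat[OF cU append_rows3_carrier[OF Z(1) z[of b b] F8, folded m]])
  have DD: "D * (D' * Y) = Y" if "Y \<in> carrier_mat b k" for Y k
    by (rule mult_mat_cancel_left[OF D(1) D'(1,2) that])
  have RDD: "R * D * (D' * Y) = R * Y" if "Y \<in> carrier_mat b k" for Y k
    using assoc_mult_mat[OF R D(1) mult_carrier_mat[OF D'(1) that]] by (simp add: DD[OF that])
  have NN: "R * F5 + (N - R * F5) = N" using R F5 N by (intro eq_matI) auto
  have sums: "R * D * (D' * M) + (N - R * F5) * S = R * M + (N - R * F5) * S"
    "R * D * (D' * F5) + (N - R * F5) * 1\<^sub>m b = N"
    "R * D * (D' * F6) + (N - R * F5) * 0\<^sub>m b d = R * F6"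
    "D * (D' * M) + 0\<^sub>m b b * S = M"
    "D * (D' * F5) + 0\<^sub>m b b * 1\<^sub>m b = F5"
    "D * (D' * F6) + 0\<^sub>m b b * 0\<^sub>m b d = F6"
    "0\<^sub>m c b * (D' * M) + F8 * S = F8 * S"
    "0\<^sub>m c b * (D' * F5) + F8 * 1\<^sub>m b = F8"
    "0\<^sub>m c b * (D' * F6) + F8 * 0\<^sub>m b d = 0\<^sub>m c d"
    using R S M F5 F6 F8
    by (simp_all add: DD RDD NN right_mult_one_mat[OF Z(1)] right_mult_zero_mat[OF Z(1)]
        left_mult_zero_mat[OF W(1)] left_mult_zero_mat[OF W(2)] left_mult_zero_mat[OF W(3)])
  have X0: "X0 = (U * L) * W + Z * (T * transpose_mat V)"
  proof -
    have cs: "R * D * (D' * M) \<in> carrier_mat a a" "R * D * (D' * F5) \<in> carrier_mat a b"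
      "R * D * (D' * F6) \<in> carrier_mat a d" "D * (D' * M) \<in> carrier_mat b a" "D * (D' * F5) \<in> carrier_mat b b"
      "D * (D' * F6) \<in> carrier_mat b d" "0\<^sub>m c b * (D' * M) \<in> carrier_mat c a"
      "0\<^sub>m c b * (D' * F5) \<in> carrier_mat c b" "0\<^sub>m c b * (D' * F6) \<in> carrier_mat c d"
      "(N - R * F5) * S \<in> carrier_mat a a" "(N - R * F5) * 1\<^sub>m b \<in> carrier_mat a b"
      "(N - R * F5) * 0\<^sub>m b d \<in> carrier_mat a d" "0\<^sub>m b b * S \<in> carrier_mat b a"
      "0\<^sub>m b b * 1\<^sub>m b \<in> carrier_mat b b" "0\<^sub>m b b * 0\<^sub>m b d \<in> carrier_mat b d"
      "F8 * S \<in> carrier_mat c a" "F8 * 1\<^sub>m b \<in> carrier_mat c b" "F8 * 0\<^sub>m b d \<in> carrier_mat c d"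
      by (rule mult_carrier_mat[OF RD W(1)] mult_carrier_mat[OF RD W(2)] mult_carrier_mat[OF RD W(3)]
          mult_carrier_mat[OF D(1) W(1)] mult_carrier_mat[OF D(1) W(2)] mult_carrier_mat[OF D(1) W(3)]
          mult_carrier_mat[OF z W(1)] mult_carrier_mat[OF z W(2)] mult_carrier_mat[OF z W(3)]
          mult_carrier_mat[OF Z(1) S] mult_carrier_mat[OF Z(1) o] mult_carrier_mat[OF Z(1) z]
          mult_carrier_mat[OF z S] mult_carrier_mat[OF z o] mult_carrier_mat[OF z z]
          mult_carrier_mat[OF F8 S] mult_carrier_mat[OF F8 o] mult_carrier_mat[OF F8 z])+
    show ?thesis
      unfolding X0_def L_def T_def W_def Z_def
        conj_mult_block3[OF cU[unfolded m] cVT[unfolded n] RD D(1) z W(1-3), folded m n]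
        conj_mult_block3[OF cU[unfolded m] cVT[unfolded n] Z(1) z F8 S o z, folded m n]
        conj_block3_add[OF cU[unfolded m] cVT[unfolded n] cs, folded m n] sums ..
  qed
  show "has_dmpgi (dual_mat X X0)"
    unfolding X X0
  proof (rule has_dmpgi_full_rank_factorization)
    show "(L' * transpose_mat U) * (U * L) = 1\<^sub>m b"
      using mult_mat_cancel_left[OF cUT cU UU cL] assoc_mult_mat[OF cL' cUT mult_carrier_mat[OF cU cL]] LL
      by simp
    show "(T * transpose_mat V) * (V * T') = 1\<^sub>m b"
      using mult_mat_cancel_left[OF cVT cV VV cT'] assoc_mult_mat[OF cT cVT mult_carrier_mat[OF cV cT']] TT
      by simp
  qed (use cU cUT cV cVT cL cL' cT cT' cW cZ in auto)
qed

text \<open>The minus order makes the ranks of \<open>E\<close> and \<open>F - E\<close> add up to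
  that of \<open>F\<close>. Hence \<open>rank_additive_orthogonal_form\<close> applies to the left
  factors of their rank factorizations, giving \<open>U\<close>, and to the transposed right
  factors, giving \<open>V\<close>.\<close>

lemma minus_le_imp_orthogonal_form:
  assumes E: "E \<in> carrier_mat m n" and F: "F \<in> carrier_mat m n" and le: "minus_le E F"
    and a: "a = mat_rank E" and ab: "mat_rank F = a + b" and m: "m = a + (b + c)" and n: "n = a + (b + d)"
  obtains U V A1 A2 A3 C1 C2 C3 where "real_orthogonal m U" "real_orthogonal n V"
    "A1 \<in> carrier_mat a a" "det A1 \<noteq> 0" "A2 \<in> carrier_mat a b" "A3 \<in> carrier_mat b b" "det A3 \<noteq> 0"
    "C1 \<in> carrier_mat a a" "det C1 \<noteq> 0" "C2 \<in> carrier_mat b a" "C3 \<in> carrier_mat b b" "det C3 \<noteq> 0"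
    "E = U * (A1 @\<^sub>r 0\<^sub>m b a @\<^sub>r 0\<^sub>m c a) * ((C1 @\<^sub>c 0\<^sub>m a b @\<^sub>c 0\<^sub>m a d) * transpose_mat V)"
    "F - E = U * (A2 @\<^sub>r A3 @\<^sub>r 0\<^sub>m c b) * ((C2 @\<^sub>c C3 @\<^sub>c 0\<^sub>m b d) * transpose_mat V)"
proof -
  have FE: "F - E \<in> carrier_mat m n" using E by auto
  have rG: "mat_rank (F - E) = b" using le a ab E F by (simp add: minus_le_def)
  have sum: "E + (F - E) = F" using E F by (intro eq_matI) auto
  obtain LE TE where LE: "LE \<in> carrier_mat m a" and TE: "TE \<in> carrier_mat a n" and eqE: "E = LE * TE"
    using rank_factorization[OF E] unfolding a .
  obtain LG TG where LG: "LG \<in> carrier_mat m b" and TG: "TG \<in> carrier_mat b n" and eqG: "F - E = LG * TG"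
    using rank_factorization[OF FE] unfolding rG .
  have eqF: "F = LE * TE + LG * TG" using sum by (simp add: eqE[symmetric] eqG[symmetric])
  obtain U A1 A2 A3 where U: "real_orthogonal m U"
    "A1 \<in> carrier_mat a a" "det A1 \<noteq> 0" "A2 \<in> carrier_mat a b" "A3 \<in> carrier_mat b b" "det A3 \<noteq> 0"
    and L: "LE = U * (A1 @\<^sub>r 0\<^sub>m b a @\<^sub>r 0\<^sub>m c a)" "LG = U * (A2 @\<^sub>r A3 @\<^sub>r 0\<^sub>m c b)"
    using rank_additive_orthogonal_form[OF LE TE LG TG a[symmetric, unfolded eqE] ab[unfolded eqF] m] .
  have ETT: "transpose_mat E = transpose_mat TE * transpose_mat LE"
    unfolding eqE by (rule transpose_mult[OF LE TE])
  have FTT: "transpose_mat F = transpose_mat TE * transpose_mat LE + transpose_mat TG * transpose_mat LG"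
    using transpose_add[OF mult_carrier_mat[OF LE TE] mult_carrier_mat[OF LG TG]]
    unfolding eqF transpose_mult[OF LE TE] transpose_mult[OF LG TG] .
  have tcs: "transpose_mat TE \<in> carrier_mat n a" "transpose_mat LE \<in> carrier_mat a m"
    "transpose_mat TG \<in> carrier_mat n b" "transpose_mat LG \<in> carrier_mat b m"
    using LE TE LG TG by auto
  have rET: "mat_rank (transpose_mat TE * transpose_mat LE) = a"
    unfolding ETT[symmetric] rank_transpose[OF E] by (rule a[symmetric])
  have rFT: "mat_rank (transpose_mat TE * transpose_mat LE + transpose_mat TG * transpose_mat LG) = a + b"
    unfolding FTT[symmetric] rank_transpose[OF F] by (rule ab)
  \<comment> \<open>The transposed sum has the same ranks, now with \<open>d\<close> remaining rows
    in place of \<open>c\<close>; the blocks \<open>C1\<close>, \<open>C2\<close>, \<open>C3\<close>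
    are the transposes of \<open>B1\<close>, \<open>B2\<close>, \<open>B3\<close>.\<close>
  obtain V B1 B2 B3 where V: "real_orthogonal n V"
    "B1 \<in> carrier_mat a a" "det B1 \<noteq> 0" "B2 \<in> carrier_mat a b" "B3 \<in> carrier_mat b b" "det B3 \<noteq> 0"
    and T: "transpose_mat TE = V * (B1 @\<^sub>r 0\<^sub>m b a @\<^sub>r 0\<^sub>m d a)"
      "transpose_mat TG = V * (B2 @\<^sub>r B3 @\<^sub>r 0\<^sub>m d b)"
    using rank_additive_orthogonal_form[OF tcs rET rFT n] .
  have tr: "X = (transpose_mat P @\<^sub>c transpose_mat Q @\<^sub>c transpose_mat R) * transpose_mat V"
    if "transpose_mat X = V * (P @\<^sub>r Q @\<^sub>r R)" "P \<in> carrier_mat a k" "Q \<in> carrier_mat b k" "R \<in> carrier_mat d k"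
    for X P Q R k
  proof -
    have "transpose_mat (transpose_mat X) = transpose_mat (P @\<^sub>r Q @\<^sub>r R) * transpose_mat V"
      unfolding that(1) using append_rows3_carrier[OF that(2-4)] V(1) n
      by (intro transpose_mult) (auto simp: real_orthogonal_def)
    thus ?thesis
      using transpose_append_rows[OF that(2) carrier_append_rows[OF that(3,4)]]
        transpose_append_rows[OF that(3,4)] by simp
  qed
  show thesis
  proof (rule that[OF U(1) V(1) U(2-6)])
    show "E = U * (A1 @\<^sub>r 0\<^sub>m b a @\<^sub>r 0\<^sub>m c a) *
        ((transpose_mat B1 @\<^sub>c 0\<^sub>m a b @\<^sub>c 0\<^sub>m a d) * transpose_mat V)"
      using tr[OF T(1) V(2), of ] eqE L by simp
    show "F - E = U * (A2 @\<^sub>r A3 @\<^sub>r 0\<^sub>m c b) *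
        ((transpose_mat B2 @\<^sub>c transpose_mat B3 @\<^sub>c 0\<^sub>m b d) * transpose_mat V)"
      using tr[OF T(2) V(4,5)] eqG L by simp
  qed (use V in \<open>auto simp: det_transpose\<close>)
qed

section \<open>The Dual-minus order as a pair of simultaneous orthogonal block forms\<close>

theorem theorem3p4:
  fixes m n re rf :: nat
    and E E0 F F0 :: "real mat"
    and Ehat Fhat :: "dual_num mat"
  assumes "E \<in> carrier_mat m n" and "E0 \<in> carrier_mat m n"
    and "F \<in> carrier_mat m n" and "F0 \<in> carrier_mat m n"
    and "Ehat = dual_mat E E0" and "Fhat = dual_mat F F0"
    and "has_dmpgi Ehat" and "has_dmpgi Fhat"
    and "re = mat_rank E" and "rf = mat_rank F"
  shows "dual_minus_le Ehat Fhat \<longleftrightarrow>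
    re \<le> rf \<and>
    (\<exists>U V D1 D2 R S M N E1 E2 E3 E4 E7 F5 F6 F8.
      real_orthogonal m U \<and> real_orthogonal n V \<and>
      D1 \<in> carrier_mat re re \<and> invertible_mat D1 \<and>
      D2 \<in> carrier_mat (rf - re) (rf - re) \<and> invertible_mat D2 \<and>
      M \<in> carrier_mat (rf - re) re \<and> S \<in> carrier_mat (rf - re) re \<and>
      N \<in> carrier_mat re (rf - re) \<and> R \<in> carrier_mat re (rf - re) \<and>
      E1 \<in> carrier_mat re re \<and> E2 \<in> carrier_mat re (rf - re) \<and>
      E3 \<in> carrier_mat re (n - rf) \<and> E4 \<in> carrier_mat (rf - re) re \<and>
      E7 \<in> carrier_mat (m - rf) re \<and>
      F5 \<in> carrier_mat (rf - re) (rf - re) \<and> F6 \<in> carrier_mat (rf - re) (n - rf) \<and>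
      F8 \<in> carrier_mat (m - rf) (rf - re) \<and>
      Ehat = dual_mat
        (U * block3_mat
               D1                  (0\<^sub>m re (rf - re))        (0\<^sub>m re (n - rf))
               (0\<^sub>m (rf - re) re)  (0\<^sub>m (rf - re) (rf - re)) (0\<^sub>m (rf - re) (n - rf))
               (0\<^sub>m (m - rf) re)   (0\<^sub>m (m - rf) (rf - re))  (0\<^sub>m (m - rf) (n - rf))
           * transpose_mat V)
        (U * block3_mat
               E1  E2                           E3
               E4  (0\<^sub>m (rf - re) (rf - re))    (0\<^sub>m (rf - re) (n - rf))
               E7  (0\<^sub>m (m - rf) (rf - re))     (0\<^sub>m (m - rf) (n - rf))
           * transpose_mat V) \<and>
      Fhat = dual_mat
        (U * block3_mat
               (D1 + R * D2 * S)  (R * D2)                   (0\<^sub>m re (n - rf))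
               (D2 * S)           D2                         (0\<^sub>m (rf - re) (n - rf))
               (0\<^sub>m (m - rf) re)  (0\<^sub>m (m - rf) (rf - re))  (0\<^sub>m (m - rf) (n - rf))
           * transpose_mat V)
        (U * block3_mat
               (E1 + R * M + N * S - R * F5 * S)  (E2 + N)  (E3 + R * F6)
               (E4 + M)                           F5        F6
               (E7 + F8 * S)                      F8        (0\<^sub>m (m - rf) (n - rf))
           * transpose_mat V))"
    (is "_ \<longleftrightarrow> _ \<and> ?form")
proof (intro iffI conjI)
  note E = assms(1) and E0 = assms(2) and F = assms(3) and F0 = assms(4)
  \<comment> \<open>The block sizes are truncated differences of naturals. Since \<open>rf\<close>
    is at most \<open>m\<close> and \<open>n\<close>, they add up exactly once
    \<open>re \<le> rf\<close> is known.\<close>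
  define a b c d where "a = re" and "b = rf - re" and "c = m - rf" and "d = n - rf"
  have "rf \<le> m"
    using rank_mult_le_inner[of "1\<^sub>m m" m m F n] F assms(10) by simp
  moreover have "rf \<le> n"
    using vec_space.rank_le_nc[of F "dim_row F" n] F assms(10) by auto
  moreover have "dim_row E = dim_row F" using E F by simp
  ultimately have dims: "m = a + (b + c)" "n = a + (b + d)" "rf = a + b" if "re \<le> rf"
    using that by (auto simp: a_def b_def c_def d_def)
  have diff: "Fhat - Ehat = dual_mat (F - E) (F0 - E0)"
    unfolding assms(5,6) by (rule dual_mat_minus[OF F F0 E E0])
  {
    assume le: "dual_minus_le Ehat Fhat"
    hence mle: "minus_le E F" and dmpgi: "has_dmpgi (dual_mat (F - E) (F0 - E0))"
      using E E0 F F0 unfolding diff[symmetric] by (auto simp: dual_minus_le_def assms(5,6))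
    \<comment> \<open>The integer difference of the ranks is itself a rank, hence
      nonnegative.\<close>
    show re_le: "re \<le> rf" using mle unfolding minus_le_def assms(9,10) by linarith
    note m = dims(1)[OF re_le] and n = dims(2)[OF re_le] and rf = dims(3)[OF re_le]
    obtain U V A1 A2 A3 C1 C2 C3 where U: "real_orthogonal m U" and V: "real_orthogonal n V"
      and A: "A1 \<in> carrier_mat a a" "det A1 \<noteq> 0" "A2 \<in> carrier_mat a b" "A3 \<in> carrier_mat b b" "det A3 \<noteq> 0"
      and C: "C1 \<in> carrier_mat a a" "det C1 \<noteq> 0" "C2 \<in> carrier_mat b a" "C3 \<in> carrier_mat b b" "det C3 \<noteq> 0"
      and eqE: "E = U * (A1 @\<^sub>r 0\<^sub>m b a @\<^sub>r 0\<^sub>m c a) * ((C1 @\<^sub>c 0\<^sub>m a b @\<^sub>c 0\<^sub>m a d) * transpose_mat V)"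
      and eqG: "F - E = U * (A2 @\<^sub>r A3 @\<^sub>r 0\<^sub>m c b) * ((C2 @\<^sub>c C3 @\<^sub>c 0\<^sub>m b d) * transpose_mat V)"
      using minus_le_imp_orthogonal_form[OF E F mle _ _ m n] rf assms(9,10) a_def by metis
    have cU: "U \<in> carrier_mat m m" and cV: "transpose_mat V \<in> carrier_mat n n"
      using U V by (auto simp: real_orthogonal_def)
    have z: "0\<^sub>m i j \<in> carrier_mat i j" for i j by simp
    \<comment> \<open>The factors of \<open>E\<close> are zero outside \<open>A1\<close> and
      \<open>C1\<close>, so only the first block row and column of \<open>E0\<close>
      survive.\<close>
    obtain W1 W2 W3 Z1 Z2 Z3 where
      W: "W1 \<in> carrier_mat a a" "W2 \<in> carrier_mat a b" "W3 \<in> carrier_mat a d" and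
      Z: "Z1 \<in> carrier_mat a a" "Z2 \<in> carrier_mat b a" "Z3 \<in> carrier_mat c a" and
      eqE0: "E0 = U * block3_mat
        (A1 * W1 + Z1 * C1) (A1 * W2 + Z1 * 0\<^sub>m a b) (A1 * W3 + Z1 * 0\<^sub>m a d)
        (0\<^sub>m b a * W1 + Z2 * C1) (0\<^sub>m b a * W2 + Z2 * 0\<^sub>m a b) (0\<^sub>m b a * W3 + Z2 * 0\<^sub>m a d)
        (0\<^sub>m c a * W1 + Z3 * C1) (0\<^sub>m c a * W2 + Z3 * 0\<^sub>m a b) (0\<^sub>m c a * W3 + Z3 * 0\<^sub>m a d)
        * transpose_mat V"
      using has_dmpgi_imp_block_form[OF U V m n A(1) z z C(1) z z E0 eqE] assms(5,7) by metis
    define E1 where "E1 = A1 * W1 + Z1 * C1"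
    have cE1: "E1 \<in> carrier_mat a a" using A C W Z by (simp add: E1_def)
    have eqE0: "E0 = U * block3_mat E1 (A1 * W2) (A1 * W3) (Z2 * C1) (0\<^sub>m b b) (0\<^sub>m b d)
        (Z3 * C1) (0\<^sub>m c b) (0\<^sub>m c d) * transpose_mat V"
      using eqE0 A C W Z by (simp add: E1_def)
    obtain W1' W2' W3' Z1' Z2' Z3' where
      W': "W1' \<in> carrier_mat b a" "W2' \<in> carrier_mat b b" "W3' \<in> carrier_mat b d" and
      Z': "Z1' \<in> carrier_mat a b" "Z2' \<in> carrier_mat b b" "Z3' \<in> carrier_mat c b" and
      eqG0: "F0 - E0 = U * block3_mat
        (A2 * W1' + Z1' * C2) (A2 * W2' + Z1' * C3) (A2 * W3' + Z1' * 0\<^sub>m b d)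
        (A3 * W1' + Z2' * C2) (A3 * W2' + Z2' * C3) (A3 * W3' + Z2' * 0\<^sub>m b d)
        (0\<^sub>m c b * W1' + Z3' * C2) (0\<^sub>m c b * W2' + Z3' * C3) (0\<^sub>m c b * W3' + Z3' * 0\<^sub>m b d)
        * transpose_mat V"
      using has_dmpgi_imp_block_form[OF U V m n A(3,4) z C(3,4) z _ eqG dmpgi] F0 E0 minus_carrier_mat
      by metis
    define G11 where "G11 = A2 * W1' + Z1' * C2"
    have cG11: "G11 \<in> carrier_mat a a" using A C W' Z' by (simp add: G11_def)
    have eqG0: "F0 - E0 = U * block3_mat
        G11 (A2 * W2' + Z1' * C3) (A2 * W3')
        (A3 * W1' + Z2' * C2) (A3 * W2' + Z2' * C3) (A3 * W3')
        (Z3' * C2) (Z3' * C3) (0\<^sub>m c d) * transpose_mat V"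
      using eqG0 A C W' Z' by (simp add: G11_def)
    obtain A3i where A3i: "A3i \<in> carrier_mat b b" "A3i * A3 = 1\<^sub>m b"
      using det_nonzero_obtain_inverse[OF A(4,5)] by metis
    obtain C3i where C3i: "C3i \<in> carrier_mat b b" "C3 * C3i = 1\<^sub>m b"
      using det_nonzero_obtain_inverse[OF C(4,5)] by metis
    \<comment> \<open>\<open>R\<close> and \<open>S\<close> solve \<open>R * A3 = A2\<close> and
      \<open>C3 * S = C2\<close>. With \<open>D2 = A3 * C3\<close>, the four nonzero blocks of
      \<open>F - E\<close> become \<open>R * D2 * S\<close>, \<open>R * D2\<close>,
      \<open>D2 * S\<close> and \<open>D2\<close>.\<close>
    define R where "R = A2 * A3i"
    define S where "S = C3i * C2"
    have R: "R \<in> carrier_mat a b" "R * A3 = A2" using A A3i by (auto simp: R_def)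
    have S: "S \<in> carrier_mat b a" "C3 * S = C2"
      using C C3i mult_mat_cancel_left[OF C(4) C3i C(3)] by (auto simp: S_def)
    define D1 where "D1 = A1 * C1"
    define D2 where "D2 = A3 * C3"
    have D1: "D1 \<in> carrier_mat a a" "invertible_mat D1" and D2: "D2 \<in> carrier_mat b b" "invertible_mat D2"
      using A C by (auto simp: D1_def D2_def invertible_mat_iff_det[of _ a] invertible_mat_iff_det[of _ b] det_mult)
    have RD: "R * D2 = A2 * C3"
      using assoc_mult_mat[OF R(1) A(4) C(4)] by (simp add: D2_def R)
    have DS: "D2 * S = A3 * C2"
      using assoc_mult_mat[OF A(4) C(4) S(1)] by (simp add: D2_def S)
    have RDS: "R * D2 * S = A2 * C2"
      using assoc_mult_mat[OF A(3) C(4) S(1)] by (simp add: RD S)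
    have eqE': "E = U * block3_mat D1 (0\<^sub>m a b) (0\<^sub>m a d) (0\<^sub>m b a) (0\<^sub>m b b) (0\<^sub>m b d)
        (0\<^sub>m c a) (0\<^sub>m c b) (0\<^sub>m c d) * transpose_mat V"
      unfolding eqE conj_mult_block3[OF cU[unfolded m] cV[unfolded n] A(1) z z C(1) z z, folded m n]
      using A C by (simp add: D1_def)
    have eqG': "F - E = U * block3_mat (R * D2 * S) (R * D2) (0\<^sub>m a d) (D2 * S) D2 (0\<^sub>m b d)
        (0\<^sub>m c a) (0\<^sub>m c b) (0\<^sub>m c d) * transpose_mat V"
      unfolding eqG conj_mult_block3[OF cU[unfolded m] cV[unfolded n] A(3,4) z C(3,4) z, folded m n]
      using A C by (simp add: D2_def[symmetric] RD DS RDS[unfolded RD])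
    have sum: "F = E + (F - E)" "F0 = E0 + (F0 - E0)" using E E0 F F0 by (auto intro!: eq_matI)
    have eqF: "F = U * block3_mat (D1 + R * D2 * S) (R * D2) (0\<^sub>m a d) (D2 * S) D2 (0\<^sub>m b d)
        (0\<^sub>m c a) (0\<^sub>m c b) (0\<^sub>m c d) * transpose_mat V"
      using trans[OF sum(1) arg_cong2[of _ _ _ _ "(+)", OF eqE' eqG']] cU cV m n D1(1) D2(1) R(1) S(1)
      by (subst (asm) conj_block3_add[of U m a b c "transpose_mat V" a b d n]) simp_all
    \<comment> \<open>\<open>M\<close>, \<open>N\<close>, \<open>F5\<close>, \<open>F6\<close> are
      read off as blocks of \<open>F0 - E0\<close>, and so is \<open>F8\<close>. The remaining
      nonzero blocks are then determined through \<open>R\<close> and \<open>S\<close>.\<close>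
    define M where "M = A3 * W1' + Z2' * C2"
    define N where "N = A2 * W2' + Z1' * C3"
    define F5 where "F5 = A3 * W2' + Z2' * C3"
    define F6 where "F6 = A3 * W3'"
    define F8 where "F8 = Z3' * C3"
    have cs: "M \<in> carrier_mat b a" "N \<in> carrier_mat a b" "F5 \<in> carrier_mat b b" "F6 \<in> carrier_mat b d"
      "F8 \<in> carrier_mat c b"
      using A C W' Z' by (auto simp: M_def N_def F5_def F6_def F8_def)
    have RF: "R * F6 = A2 * W3'" using assoc_mult_mat[OF R(1) A(4) W'(3)] by (simp add: F6_def R)
    have FS: "F8 * S = Z3' * C2" using assoc_mult_mat[OF Z'(3) C(4) S(1)] by (simp add: F8_def S)
    have id: "E1 + R * M + N * S - R * F5 * S = E1 + G11"
      unfolding M_def N_def F5_def G11_def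
      by (rule dual_minus_block_identity[OF cE1 A(3,4) C(3,4) W'(1,2) Z'(1,2) R(1) S(1) R(2) S(2)])
    have eqF0: "F0 = U * block3_mat (E1 + R * M + N * S - R * F5 * S) (A1 * W2 + N) (A1 * W3 + R * F6)
        (Z2 * C1 + M) F5 F6 (Z3 * C1 + F8 * S) F8 (0\<^sub>m c d) * transpose_mat V"
      using trans[OF sum(2) arg_cong2[of _ _ _ _ "(+)", OF eqE0 eqG0]] cU cV m n cE1 cG11 A C W Z W' Z'
      unfolding id RF FS unfolding M_def N_def F5_def F6_def F8_def
      by (subst (asm) conj_block3_add[of U m a b c "transpose_mat V" a b d n]) simp_all
    have cAW: "A1 * W2 \<in> carrier_mat a b" "A1 * W3 \<in> carrier_mat a d"
      "Z2 * C1 \<in> carrier_mat b a" "Z3 * C1 \<in> carrier_mat c a"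
      using A C W Z by auto
    \<comment> \<open>\<open>E2\<close>, \<open>E3\<close>, \<open>E4\<close>, \<open>E7\<close> are
      the outer blocks of \<open>E0\<close>. The size differences are folded before
      \<open>re\<close>, because folding \<open>re\<close> first would break up
      \<open>rf - re\<close>.\<close>
    show ?form
      unfolding b_def[symmetric] c_def[symmetric] d_def[symmetric] unfolding a_def[symmetric] assms(5,6)
      by (rule exI[of _ U], rule exI[of _ V], rule exI[of _ D1], rule exI[of _ D2], rule exI[of _ R],
        rule exI[of _ S], rule exI[of _ M], rule exI[of _ N], rule exI[of _ E1], rule exI[of _ "A1 * W2"],
        rule exI[of _ "A1 * W3"], rule exI[of _ "Z2 * C1"], rule exI[of _ "Z3 * C1"], rule exI[of _ F5], rule exI[of _ F6],
        rule exI[of _ F8],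
        intro conjI U V D1 D2 R(1) S(1) cs cE1 cAW arg_cong2[of _ _ _ _ dual_mat, OF eqE' eqE0]
          arg_cong2[of _ _ _ _ dual_mat, OF eqF eqF0])
  }
  show "dual_minus_le Ehat Fhat" if "re \<le> rf \<and> ?form"
  proof -
    from that have re_le: "re \<le> rf" and form: ?form by auto
    note m = dims(1)[OF re_le] and n = dims(2)[OF re_le] and rf = dims(3)[OF re_le]
    from form obtain U V D1 D2 R S M N E1 E2 E3 E4 E7 F5 F6 F8 where
      U: "real_orthogonal m U" and V: "real_orthogonal n V" and
      D1: "D1 \<in> carrier_mat a a" and D2: "D2 \<in> carrier_mat b b" "invertible_mat D2" and
      M: "M \<in> carrier_mat b a" and S: "S \<in> carrier_mat b a" and
      N: "N \<in> carrier_mat a b" and R: "R \<in> carrier_mat a b" and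
      Es: "E1 \<in> carrier_mat a a" "E2 \<in> carrier_mat a b" "E3 \<in> carrier_mat a d"
        "E4 \<in> carrier_mat b a" "E7 \<in> carrier_mat c a" and
      Fs: "F5 \<in> carrier_mat b b" "F6 \<in> carrier_mat b d" "F8 \<in> carrier_mat c b" and
      eqEh: "dual_mat E E0 = dual_mat
        (U * block3_mat D1 (0\<^sub>m a b) (0\<^sub>m a d) (0\<^sub>m b a) (0\<^sub>m b b) (0\<^sub>m b d)
          (0\<^sub>m c a) (0\<^sub>m c b) (0\<^sub>m c d) * transpose_mat V)
        (U * block3_mat E1 E2 E3 E4 (0\<^sub>m b b) (0\<^sub>m b d) E7 (0\<^sub>m c b) (0\<^sub>m c d) * transpose_mat V)" and
      eqFh: "dual_mat F F0 = dual_mat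
        (U * block3_mat (D1 + R * D2 * S) (R * D2) (0\<^sub>m a d) (D2 * S) D2 (0\<^sub>m b d)
          (0\<^sub>m c a) (0\<^sub>m c b) (0\<^sub>m c d) * transpose_mat V)
        (U * block3_mat (E1 + R * M + N * S - R * F5 * S) (E2 + N) (E3 + R * F6) (E4 + M) F5 F6
          (E7 + F8 * S) F8 (0\<^sub>m c d) * transpose_mat V)"
      unfolding b_def[symmetric] c_def[symmetric] d_def[symmetric] unfolding a_def[symmetric] assms(5,6) by (elim exE conjE) (rule that; assumption)
    have cU: "U \<in> carrier_mat m m" and cV: "transpose_mat V \<in> carrier_mat n n"
      using U V by (auto simp: real_orthogonal_def)
    have cB: "U * block3_mat A11 A12 A13 A21 A22 A23 A31 A32 A33 * transpose_mat V \<in> carrier_mat m n"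
      if "A11 \<in> carrier_mat a a" "A12 \<in> carrier_mat a b" "A13 \<in> carrier_mat a d"
        "A21 \<in> carrier_mat b a" "A22 \<in> carrier_mat b b" "A23 \<in> carrier_mat b d"
        "A31 \<in> carrier_mat c a" "A32 \<in> carrier_mat c b" "A33 \<in> carrier_mat c d"
      for A11 A12 A13 A21 A22 A23 A31 A32 A33
      using block3_mat_carrier[OF that, folded m n] cU cV by auto
    have eqE: "E = U * block3_mat D1 (0\<^sub>m a b) (0\<^sub>m a d) (0\<^sub>m b a) (0\<^sub>m b b) (0\<^sub>m b d)
          (0\<^sub>m c a) (0\<^sub>m c b) (0\<^sub>m c d) * transpose_mat V"
      and eqE0: "E0 = U * block3_mat E1 E2 E3 E4 (0\<^sub>m b b) (0\<^sub>m b d) E7 (0\<^sub>m c b) (0\<^sub>m c d) * transpose_mat V"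
      using eqEh by (subst (asm) dual_mat_eq_iff[OF E E0]; use D1 Es in \<open>simp add: cB\<close>)+
    have eqF: "F = U * block3_mat (D1 + R * D2 * S) (R * D2) (0\<^sub>m a d) (D2 * S) D2 (0\<^sub>m b d)
          (0\<^sub>m c a) (0\<^sub>m c b) (0\<^sub>m c d) * transpose_mat V"
      and eqF0: "F0 = U * block3_mat (E1 + R * M + N * S - R * F5 * S) (E2 + N) (E3 + R * F6) (E4 + M) F5 F6
          (E7 + F8 * S) F8 (0\<^sub>m c d) * transpose_mat V"
      using eqFh by (subst (asm) dual_mat_eq_iff[OF F F0]; use D1 D2 R S M N Es Fs in \<open>simp add: cB minus_carrier_mat\<close>)+
    \<comment> \<open>The candidates for \<open>F - E\<close> and \<open>F0 - E0\<close>; that they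
      are the differences follows by adding them blockwise to \<open>E\<close> and
      \<open>E0\<close>.\<close>
    define X where "X = U * block3_mat (R * D2 * S) (R * D2) (0\<^sub>m a d) (D2 * S) D2 (0\<^sub>m b d)
      (0\<^sub>m c a) (0\<^sub>m c b) (0\<^sub>m c d) * transpose_mat V"
    define X0 where "X0 = U * block3_mat (R * M + (N - R * F5) * S) N (R * F6) M F5 F6
      (F8 * S) F8 (0\<^sub>m c d) * transpose_mat V"
    note diff_props = orthogonal_block_difference[OF U V m n D2 R S M N Fs, folded X_def X0_def]
    have cNS: "(N - R * F5) * S \<in> carrier_mat a a"
      by (rule mult_carrier_mat[OF minus_carrier_mat[OF mult_carrier_mat[OF R Fs(1)]] S])
    have cX: "X \<in> carrier_mat m n" and cX0: "X0 \<in> carrier_mat m n"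
      unfolding X_def X0_def by (rule cB; use D2 R S M N Fs cNS in simp)+
    have "E + X = F"
      unfolding eqE eqF X_def
      by (subst conj_block3_add[of U m a b c "transpose_mat V" a b d n])
        (use cU cV m n D1 D2 R S in simp_all)
    hence X: "F - E = X" using E cX by (auto intro!: eq_matI)
    \<comment> \<open>Regroups the top left block from the shape \<open>L * W + Z * T\<close> into
      the one in the stated form.\<close>
    have "E1 + (R * M + (N - R * F5) * S) = E1 + R * M + N * S - R * F5 * S"
    proof -
      have "(N - R * F5) * S = N * S - R * F5 * S"
        by (rule minus_mult_distrib_mat) (use N R Fs S in auto)
      moreover have "A + (B + (C - D)) = A + B + C - D"
        if "A \<in> carrier_mat a a" "B \<in> carrier_mat a a" "C \<in> carrier_mat a a" "D \<in> carrier_mat a a"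
        for A B C D :: "real mat"
        using that by (intro eq_matI) auto
      note this[OF Es(1) mult_carrier_mat[OF R M] mult_carrier_mat[OF N S]
          mult_carrier_mat[OF mult_carrier_mat[OF R Fs(1)] S]]
      ultimately show ?thesis by simp
    qed
    hence "E0 + X0 = F0"
      unfolding eqE0 eqF0 X0_def
      by (subst conj_block3_add[of U m a b c "transpose_mat V" a b d n])
        (use cU cV m n R S M N Es Fs cNS in simp_all)
    hence X0: "F0 - E0 = X0" using E0 cX0 by (auto intro!: eq_matI)
    \<comment> \<open>Subadditivity bounds the rank of the difference from below by
      \<open>rf - re\<close>; the factorization through \<open>b\<close> bounds it from above, and
      equality is the minus order.\<close>
    have "mat_rank F \<le> mat_rank E + mat_rank X"
      using rank_add_le[OF E cX] \<open>E + X = F\<close> by simp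
    hence "minus_le E F"
      using diff_props(1) rf E F assms(9,10) a_def by (simp add: minus_le_def X)
    thus ?thesis
      using diff_props(2) assms(7,8) E E0 F F0 unfolding dual_minus_le_def diff X X0
      by (simp add: assms(5,6))
  qed
qed

end
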